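(* A $G_n$-polygon is amenable: if $\mathcal{C}$ is a $G_n$-polygonal properly open convex set in $\mathbb{P}^n$, then the Hilbert geometry $(\mathcal{C},d_{\mathcal{C}})$ is amenable.
   Context: A properly open convex set of the real projective space $\mathbb{P}^n$ is a nonempty open set which, in some affine chart $\cong\mathbb{R}^n$ (complement of a projective hyperplane), is a bounded open convex set. Its Hilbert distance (projectively invariant) is: for distinct $p,q\in\mathcal{C}$, the line through $p,q$ meets $\partial\mathcal{C}$ at $a,b$, in the order $a,p,q,b$, and $d_{\mathcal{C}}(p,q)=\frac12\ln\left(\frac{\|q-a\|}{\|p-a\|}\cdot\frac{\|p-b\|}{\|q-b\|}\right)$ with $\|\cdot\|$ the Euclidean norm of the chart; $d_{\mathcal{C}}(p,p)=0$. $G_n$ denotes the group of projective transformations of $\mathbb{P}^n$. The space of properly open convex sets is endowed with the Hausdorff topology (Hausdorff convergence of closures in $\mathbb{P}^n$). A polygon is a properly open convex set which, in an affine chart, is the interior of an $n$-dimensional convex polytope. $\mathcal{C}$ is $G_n$-polygonal (a $G_n$-polygon) if the closure $\overline{G_n\mathcal{C}}$ of its orbit, in the space of properly open convex sets, contains a polygon. Amenability: a separated net $X\subset\mathcal{C}$ is a subset for which there is $r>0$ such that $d_{\mathcal{C}}(x,y)\ge r$ for all distinct $x,y\in X$ and $X$ is maximal for this property. $\mathcal{W}(X)$ is the pseudogroup of bounded perturbations of the identity, i.e. all bijections $\gamma:S\to T$ between subsets $S,T\subset X$ with $\sup_{x\in S}d_{\mathcal{C}}(\gamma(x),x)<\infty$.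 $\mathcal{W}(X)$ is amenable if there is a finitely additive $\mu:\mathcal{P}(X)\to[0,1]$ ($\mathcal{P}(X)$ the set of all subsets of $X$) with $\mu(X)=1$ and $\mu(S)=\mu(T)$ for every $\gamma:S\to T$ in $\mathcal{W}(X)$. $\mathcal{C}$ is amenable if $\mathcal{W}(X)$ is amenable for some separated net $X$ of $\mathcal{C}$. *)

theory Defs
  imports "HOL-Analysis.Analysis"
begin

section \<open>Real projective space\<close>

typedef (overloaded) ('a::euclidean_space) proj = "{L :: 'a set. subspace L \<and> dim L = 1}"
proof -
  obtain b :: 'a where "b \<in> Basis" using nonempty_Basis by blast
  then have "dim (span {b}) = 1"
    by (simp add: dim_eq_card_independent nonzero_Basis)
  then show ?thesis by (intro exI[of _ "span {b}"]) auto
qed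

text \<open>Only meaningful for nonzero vectors.\<close>
definition proj_pt :: "'a::euclidean_space \<Rightarrow> 'a proj" where
  "proj_pt v = Abs_proj (span {v})"

lemma Rep_proj_pt: "v \<noteq> 0 \<Longrightarrow> Rep_proj (proj_pt v) = span {v}"
  unfolding proj_pt_def by (rule Abs_proj_inverse) (simp add: dim_eq_card_independent)

lemma proj_pt_cases:
  obtains u where "norm u = 1" "P = proj_pt u"
proof -
  have P: "subspace (Rep_proj P)" "dim (Rep_proj P) = 1" using Rep_proj[of P] by auto
  then have "\<not> Rep_proj P \<subseteq> {0}" by (metis dim_eq_0 zero_neq_one)
  then obtain v where v: "v \<in> Rep_proj P" "v \<noteq> 0" by auto
  define u where "u = v /\<^sub>R norm v"
  have u: "norm u = 1" "u \<in> Rep_proj P" using v P by (auto simp: u_def subspace_scale)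
  then have "u \<noteq> 0" by auto
  have "span {u} \<subseteq> Rep_proj P" using u P by (simp add: span_minimal)
  moreover have "dim (span {u}) = dim (Rep_proj P)"
    using \<open>u \<noteq> 0\<close> P by (simp add: dim_eq_card_independent)
  ultimately have "span {u} = Rep_proj P"
    using P by (metis order.refl subspace_dim_equal subspace_span)
  then have "P = proj_pt u" unfolding proj_pt_def by (simp add: Rep_proj_inverse)
  with u that show ?thesis by blast
qed

lemma proj_pt_eq_iff:
  assumes "u \<noteq> 0" "v \<noteq> 0"
  shows "proj_pt u = proj_pt v \<longleftrightarrow> (\<exists>c. c \<noteq> 0 \<and> u = c *\<^sub>R v)"
proof
  assume "proj_pt u = proj_pt v"
  then have "span {u} = span {v}" using Rep_proj_pt assms by metis
  then have "u \<in> span {v}" by (metis insertI1 span_base)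
  then show "\<exists>c. c \<noteq> 0 \<and> u = c *\<^sub>R v" using assms by (auto simp: span_singleton)
next
  assume "\<exists>c. c \<noteq> 0 \<and> u = c *\<^sub>R v"
  then obtain c where c: "c \<noteq> 0" "u = c *\<^sub>R v" by blast
  have "span {u} = span {v}"
    using c span_image_scale[of "{v}" "\<lambda>_. c"] by simp
  then show "proj_pt u = proj_pt v" by (simp add: proj_pt_def)
qed

text \<open>The chordal metric. It induces the quotient topology (see \<open>open_proj_iff\<close> below), and the
  Hausdorff topology on the closed subsets of the compact space does not depend on the choice of
  such a metric.\<close>

instantiation proj :: (euclidean_space) metric_space
begin

definition dist_proj :: "'a proj \<Rightarrow> 'a proj \<Rightarrow> real" where
  "dist_proj P Q = Inf {norm (u - v) | u v. u \<in> Rep_proj P \<and> v \<in> Rep_proj Q \<and> norm u = 1 \<and> norm v = 1}"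

definition uniformity_proj :: "('a proj \<times> 'a proj) filter" where
  "uniformity_proj = (INF e\<in>{0 <..}. principal {(P, Q). dist P Q < e})"

definition open_proj :: "'a proj set \<Rightarrow> bool" where
  "open_proj U \<longleftrightarrow> (\<forall>P\<in>U. eventually (\<lambda>(P', Q). P' = P \<longrightarrow> Q \<in> U) uniformity)"

lemma unit_span: "norm u = 1 \<Longrightarrow> w \<in> span {u} \<and> norm w = 1 \<longleftrightarrow> w = u \<or> w = - u" for u w :: 'a
proof -
  assume u: "norm u = 1"
  have "w = u \<or> w = - u" if "w = c *\<^sub>R u" "norm w = 1" for c
  proof -
    have "\<bar>c\<bar> = 1" using that u by simp
    then have "c = 1 \<or> c = - 1" by linarith
    then show ?thesis using that(1) by auto
  qed
  moreover have "u \<in> span {u}" "- u \<in> span {u}" by (simp_all add: span_base span_neg)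
  moreover have "w = u \<or> w = - u \<Longrightarrow> norm w = 1" using u by auto
  moreover have "w \<in> span {u} \<longleftrightarrow> (\<exists>c. w = c *\<^sub>R u)" by (auto simp: span_singleton)
  ultimately show ?thesis by metis
qed

lemma dist_proj_pt:
  fixes u v :: 'a
  assumes "norm u = 1" "norm v = 1"
  shows "dist (proj_pt u) (proj_pt v) = min (norm (u - v)) (norm (u + v))"
proof -
  have "u \<noteq> 0" "v \<noteq> 0" using assms by auto
  have "u' \<in> Rep_proj (proj_pt u) \<and> v' \<in> Rep_proj (proj_pt v) \<and> norm u' = 1 \<and> norm v' = 1
     \<longleftrightarrow> (u' = u \<or> u' = -u) \<and> (v' = v \<or> v' = -v)" for u' v'
    unfolding Rep_proj_pt[OF \<open>u \<noteq> 0\<close>] Rep_proj_pt[OF \<open>v \<noteq> 0\<close>]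
    using unit_span[OF assms(1), of u'] unit_span[OF assms(2), of v'] by blast
  then have "{norm (u' - v') | u' v'. u' \<in> Rep_proj (proj_pt u) \<and> v' \<in> Rep_proj (proj_pt v) \<and> norm u' = 1 \<and> norm v' = 1}
     = {norm (u' - v') | u' v'. (u' = u \<or> u' = -u) \<and> (v' = v \<or> v' = -v)}" by simp
  also have "\<dots> = {norm (u - v), norm (u + v)}"
  proof -
    have "norm (- u - v) = norm (u + v)"
      using norm_minus_cancel[of "u + v"] by simp
    moreover have "norm (- u - - v) = norm (u - v)"
      using norm_minus_commute[of v u] by simp
    moreover have "norm (u - - v) = norm (u + v)" by simp
    moreover have "{norm (u' - v') | u' v'. (u' = u \<or> u' = -u) \<and> (v' = v \<or> v' = -v)}
      = {norm (u - v), norm (u - - v), norm (- u - v), norm (- u - - v)}" by blast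
    ultimately show ?thesis by auto
  qed
  finally show ?thesis unfolding dist_proj_def by (simp add: cInf_eq_Min)
qed

instance
proof
  fix P Q R :: "'a proj"
  obtain u where u: "norm u = 1" "P = proj_pt u" by (rule proj_pt_cases)
  obtain v where v: "norm v = 1" "Q = proj_pt v" by (rule proj_pt_cases)
  obtain w where w: "norm w = 1" "R = proj_pt w" by (rule proj_pt_cases)
  have uv: "u \<noteq> 0" "v \<noteq> 0" using u v by auto
  have PQ: "dist P Q = min (norm (u - v)) (norm (u + v))" using u v by (simp add: dist_proj_pt)
  have "proj_pt u = proj_pt v \<longleftrightarrow> u = v \<or> u = - v"
  proof
    assume "proj_pt u = proj_pt v"
    then have "u \<in> span {v}" using Rep_proj_pt uv by (metis insertI1 span_base)
    then show "u = v \<or> u = - v" using unit_span u v by blast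
  next
    assume "u = v \<or> u = - v"
    then show "proj_pt u = proj_pt v" using proj_pt_eq_iff[OF uv]
      by (metis neg_equal_0_iff_equal scaleR_minus1_left scaleR_one zero_neq_one)
  qed
  then show "dist P Q = 0 \<longleftrightarrow> P = Q"
    unfolding PQ using u v by (auto simp: min_def eq_neg_iff_add_eq_0)
  have "norm (u - v) \<le> norm (u - w) + norm (v - w)" "norm (u - v) \<le> norm (u + w) + norm (v + w)"
       "norm (u + v) \<le> norm (u - w) + norm (v + w)" "norm (u + v) \<le> norm (u + w) + norm (v - w)"
    using norm_triangle_ineq4[of "u - w" "v - w"] norm_triangle_ineq4[of "u + w" "v + w"]
      norm_triangle_ineq[of "u - w" "v + w"] norm_triangle_ineq[of "u + w" "v - w"]
    by (simp_all add: algebra_simps)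
  then show "dist P Q \<le> dist P R + dist Q R"
    using u v w by (auto simp: dist_proj_pt min_def)
qed (rule uniformity_proj_def open_proj_def)+

end

lemma open_proj_iff: "open U \<longleftrightarrow> open {v. v \<noteq> 0 \<and> proj_pt v \<in> U}"
proof
  have scl: "proj_pt (v /\<^sub>R norm v) = proj_pt v" if "v \<noteq> 0" for v :: 'a
  proof -
    have "v /\<^sub>R norm v \<noteq> 0" using that by simp
    then show ?thesis using that proj_pt_eq_iff
      by (metis inverse_nonzero_iff_nonzero norm_eq_zero)
  qed
  have le: "dist (proj_pt u) (proj_pt v) \<le> norm (u - v)" if "norm u = 1" "norm v = 1" for u v :: 'a
    using that by (simp add: dist_proj_pt)
  show "open {v. v \<noteq> 0 \<and> proj_pt v \<in> U}" if U: "open U"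
  proof -
    have "continuous_on (- {0}) (proj_pt :: 'a \<Rightarrow> 'a proj)"
      unfolding continuous_on_iff
    proof (intro ballI allI impI)
      fix v :: 'a and e :: real assume v: "v \<in> - {0}" and "e > 0"
      have "continuous_on (- {0}) (\<lambda>x::'a. x /\<^sub>R norm x)" by (intro continuous_intros) auto
      then obtain d where d: "d > 0" "\<forall>x\<in>-{0}. dist x v < d \<longrightarrow> dist (x /\<^sub>R norm x) (v /\<^sub>R norm v) < e"
        using v \<open>e > 0\<close> unfolding continuous_on_iff by blast
      have "dist (proj_pt x) (proj_pt v) < e" if x: "x \<in> - {0}" "dist x v < d" for x
      proof -
        have "dist (proj_pt x) (proj_pt v) = dist (proj_pt (x /\<^sub>R norm x)) (proj_pt (v /\<^sub>R norm v))"
          using x v scl by auto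
        also have "\<dots> \<le> norm (x /\<^sub>R norm x - v /\<^sub>R norm v)" using x v by (intro le) auto
        also have "\<dots> < e" using d x by (auto simp: dist_norm)
        finally show ?thesis .
      qed
      then show "\<exists>d>0. \<forall>x\<in>- {0}. dist x v < d \<longrightarrow> dist (proj_pt x) (proj_pt v) < e" using d by blast
    qed
    then have "open (proj_pt -` U \<inter> - {0})"
      using U by (simp add: continuous_on_open_vimage open_Compl)
    also have "proj_pt -` U \<inter> - {0} = {v. v \<noteq> 0 \<and> proj_pt v \<in> U}" by auto
    finally show ?thesis .
  qed
  show "open U" if V: "open {v. v \<noteq> 0 \<and> proj_pt v \<in> U}"
    unfolding open_dist
  proof
    fix P assume P: "P \<in> U"
    obtain u where u: "norm u = 1" "P = proj_pt u" by (rule proj_pt_cases)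
    then have "u \<in> {v. v \<noteq> 0 \<and> proj_pt v \<in> U}" using P by auto
    then obtain e where e: "e > 0" "\<forall>y. dist y u < e \<longrightarrow> y \<noteq> 0 \<and> proj_pt y \<in> U"
      using V unfolding open_dist by blast
    have "Q \<in> U" if Q: "dist Q P < e" for Q
    proof -
      obtain v where v: "norm v = 1" "Q = proj_pt v" by (rule proj_pt_cases)
      have v0: "v \<noteq> 0" using v by auto
      have "proj_pt (- v) = proj_pt v"
        unfolding proj_pt_def using span_image_scale[of "{v}" "\<lambda>_. -1"] by simp
      moreover have "norm (v - u) < e \<or> norm (v + u) < e"
        using Q u v by (auto simp: dist_proj_pt min_less_iff_disj)
      moreover have "norm (v + u) = dist (- v) u"
        using norm_minus_cancel[of "v + u"] by (simp add: dist_norm)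
      ultimately show ?thesis using e v by (metis dist_norm)
    qed
    then show "\<exists>e>0. \<forall>Q. dist Q P < e \<longrightarrow> Q \<in> U" using e by blast
  qed
qed


section \<open>Projective transformations and affine charts\<close>

type_synonym 'n rpn = "((real^'n) \<times> real) proj"

definition proj_map :: "('a::euclidean_space \<Rightarrow> 'a) \<Rightarrow> 'a proj \<Rightarrow> 'a proj" where
  "proj_map A P = Abs_proj (A ` Rep_proj P)"

definition projective_group :: "('a::euclidean_space proj \<Rightarrow> 'a proj) set" where
  "projective_group = {proj_map A | A. linear A \<and> bij A}"

text \<open>For a linear automorphism \<open>A\<close>, this identifies \<open>real^'n\<close> with the complement of the projective
  hyperplane that is the image under \<open>A\<close> of the hyperplane at infinity; every affine
  identification of the complement of a hyperplane with \<open>real^'n\<close> is of this form.\<close>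
definition affine_chart ::
    "((real^'n) \<times> real \<Rightarrow> (real^'n) \<times> real) \<Rightarrow> real^'n \<Rightarrow> 'n::finite rpn" where
  "affine_chart A x = proj_pt (A (x, 1))"

definition proper_chart ::
    "((real^'n) \<times> real \<Rightarrow> (real^'n) \<times> real) \<Rightarrow> 'n::finite rpn set \<Rightarrow> bool" where
  "proper_chart A C \<longleftrightarrow> linear A \<and> bij A \<and>
     (\<exists>D. open D \<and> bounded D \<and> convex D \<and> C = affine_chart A ` D)"

definition properly_open_convex :: "'n::finite rpn set \<Rightarrow> bool" where
  "properly_open_convex C \<longleftrightarrow> C \<noteq> {} \<and> (\<exists>A. proper_chart A C)"

definition polygon :: "'n::finite rpn set \<Rightarrow> bool" where
  "polygon C \<longleftrightarrow> properly_open_convex C \<and>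
     (\<exists>A K. linear A \<and> bij A \<and> polytope K \<and> aff_dim K = int CARD('n) \<and>
        C = affine_chart A ` interior K)"


section \<open>The Hausdorff topology on properly open convex sets\<close>

definition hausdorff_dist :: "'a::metric_space set \<Rightarrow> 'a set \<Rightarrow> real" where
  "hausdorff_dist S T =
     Inf {e. 0 \<le> e \<and> (\<forall>x\<in>S. infdist x T \<le> e) \<and> (\<forall>y\<in>T. infdist y S \<le> e)}"

definition hausdorff_topology :: "'n::finite rpn set topology" where
  "hausdorff_topology = Metric_space.mtopology {C. properly_open_convex C}
     (\<lambda>C D. hausdorff_dist (closure C) (closure D))"

definition G_polygonal :: "'n::finite rpn set \<Rightarrow> bool" where
  "G_polygonal C \<longleftrightarrow>
     (\<exists>P \<in> hausdorff_topology closure_of {g ` C | g. g \<in> projective_group}. polygon P)"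

text \<open>The topology above is the one of a genuine metric: a properly open convex set is determined
  by its closure.\<close>

lemma dist_proj_le_2: "dist P (Q :: 'a::euclidean_space proj) \<le> 2"
proof -
  obtain u where u: "norm u = 1" "P = proj_pt u" by (rule proj_pt_cases)
  obtain v where v: "norm v = 1" "Q = proj_pt v" by (rule proj_pt_cases)
  have "dist P Q \<le> norm (u - v)" using u v by (simp add: dist_proj_pt)
  then show ?thesis using norm_triangle_ineq4[of u v] u v by simp
qed

lemma hausdorff_dist_le:
  assumes "0 \<le> e" "\<And>x. x \<in> S \<Longrightarrow> infdist x T \<le> e" "\<And>y. y \<in> T \<Longrightarrow> infdist y S \<le> e"
  shows "hausdorff_dist S T \<le> e"
  unfolding hausdorff_dist_def by (rule cInf_lower) (use assms in \<open>auto simp: bdd_below_def\<close>)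

lemma hausdorff_dist_nonempty:
  fixes S T :: "'a::euclidean_space proj set"
  shows "{e. 0 \<le> e \<and> (\<forall>x\<in>S. infdist x T \<le> e) \<and> (\<forall>y\<in>T. infdist y S \<le> e)} \<noteq> {}"
proof -
  have "infdist x S \<le> 2" for x and S :: "'a proj set"
    by (cases "S = {}") (auto simp: infdist_def intro!: cINF_lower2 dist_proj_le_2)
  then have "2 \<in> {e. 0 \<le> e \<and> (\<forall>x\<in>S. infdist x T \<le> e) \<and> (\<forall>y\<in>T. infdist y S \<le> e)}" by simp
  then show ?thesis by blast
qed

lemma hausdorff_dist_lessD:
  fixes S T :: "'a::euclidean_space proj set"
  assumes "hausdorff_dist S T < e"
  shows "x \<in> S \<Longrightarrow> infdist x T < e" "y \<in> T \<Longrightarrow> infdist y S < e"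
  using cInf_lessD[OF hausdorff_dist_nonempty assms[unfolded hausdorff_dist_def]] by force+

lemma continuous_on_proj_pt: "continuous_on (- {0}) (proj_pt :: 'a::euclidean_space \<Rightarrow> 'a proj)"
proof -
  have "open (proj_pt -` U \<inter> - {0} :: 'a set)" if "open U" for U :: "'a proj set"
  proof -
    have "proj_pt -` U \<inter> - {0} = {v :: 'a. v \<noteq> 0 \<and> proj_pt v \<in> U}" by auto
    then show ?thesis using that open_proj_iff by metis
  qed
  then show ?thesis by (simp add: continuous_on_open_vimage open_Compl)
qed

context
  fixes A :: "(real^'n::finite) \<times> real \<Rightarrow> (real^'n) \<times> real"
  assumes A: "linear A" "bij A"
begin

lemma chart_vec_nonzero: "A (x, 1) \<noteq> 0"
proof
  assume "A (x, 1) = 0"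
  then have "A (x, 1) = A 0" using A by (simp add: linear_0)
  then show False using A by (simp add: bij_is_inj inj_eq zero_prod_def)
qed

lemma affine_chart_eq_iff:
  assumes "v \<noteq> 0"
  shows "proj_pt v = affine_chart A x \<longleftrightarrow>
    snd (inv A v) \<noteq> 0 \<and> x = fst (inv A v) /\<^sub>R snd (inv A v)"
proof -
  have "proj_pt v = affine_chart A x \<longleftrightarrow> (\<exists>c. c \<noteq> 0 \<and> v = c *\<^sub>R A (x, 1))"
    unfolding affine_chart_def by (rule proj_pt_eq_iff[OF assms chart_vec_nonzero])
  also have "\<dots> \<longleftrightarrow> (\<exists>c. c \<noteq> 0 \<and> v = A (c *\<^sub>R x, c))"
    using linear_cmul[OF A(1), of _ "(x, 1)"] by simp
  also have "\<dots> \<longleftrightarrow> (\<exists>c. c \<noteq> 0 \<and> inv A v = (c *\<^sub>R x, c))"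
    using A(2) by (metis bij_inv_eq_iff)
  also have "\<dots> \<longleftrightarrow> snd (inv A v) \<noteq> 0 \<and> x = fst (inv A v) /\<^sub>R snd (inv A v)"
    by (cases "inv A v") auto
  finally show ?thesis .
qed

lemma inj_affine_chart: "inj (affine_chart A)"
proof (rule injI)
  fix x y assume "affine_chart A x = affine_chart A y"
  then have "proj_pt (A (x, 1)) = affine_chart A y" by (simp add: affine_chart_def)
  then show "x = y" using affine_chart_eq_iff[OF chart_vec_nonzero] A
    by (simp add: bij_is_inj)
qed

lemma continuous_affine_chart: "continuous_on UNIV (affine_chart A)"
proof -
  have "continuous_on UNIV (\<lambda>x. A (x, 1))"
    using linear_continuous_on_compose[OF _ A(1), of UNIV "\<lambda>x. (x, 1)"]
    by (simp add: continuous_on_Pair)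
  then show ?thesis unfolding affine_chart_def
    by (rule continuous_on_compose2[OF continuous_on_proj_pt]) (use chart_vec_nonzero in auto)
qed

lemma open_affine_chart:
  assumes "open D"
  shows "open (affine_chart A ` D)"
proof -
  let ?B = "inv A"
  have B: "linear ?B" using A by (simp add: inj_linear_imp_inv_linear bij_is_inj)
  have nz: "?B v \<noteq> 0 \<longleftrightarrow> v \<noteq> 0" for v
    using A by (metis bij_inv_eq_iff linear_0)
  have "{v. v \<noteq> 0 \<and> proj_pt v \<in> affine_chart A ` D} =
     (\<lambda>v. fst (?B v) /\<^sub>R snd (?B v)) -` D \<inter> {v. snd (?B v) \<noteq> 0}"
  proof (intro set_eqI)
    fix v
    show "v \<in> {v. v \<noteq> 0 \<and> proj_pt v \<in> affine_chart A ` D} \<longleftrightarrow>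
        v \<in> (\<lambda>v. fst (?B v) /\<^sub>R snd (?B v)) -` D \<inter> {v. snd (?B v) \<noteq> 0}"
    proof (cases "v = 0")
      case True
      then show ?thesis using nz[of v] by simp
    next
      case False
      have "proj_pt v \<in> affine_chart A ` D \<longleftrightarrow> (\<exists>x\<in>D. proj_pt v = affine_chart A x)" by (rule image_iff)
      also have "\<dots> \<longleftrightarrow> snd (?B v) \<noteq> 0 \<and> fst (?B v) /\<^sub>R snd (?B v) \<in> D"
        unfolding affine_chart_eq_iff[OF False] by blast
      finally show ?thesis using False by (simp only: mem_Collect_eq Int_iff vimage_eq simp_thms) blast
    qed
  qed
  moreover have "open \<dots>"
  proof -
    have c: "continuous_on S ?B" for S using B by (rule linear_continuous_on[OF linear_conv_bounded_linear[THEN iffD1]])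
    have "open {v. snd (?B v) \<noteq> 0}"
      by (intro open_Collect_neq continuous_intros c)
    moreover have "continuous_on {v. snd (?B v) \<noteq> 0} (\<lambda>v. fst (?B v) /\<^sub>R snd (?B v))"
      by (intro continuous_intros c) auto
    ultimately show ?thesis using assms continuous_on_open_vimage by blast
  qed
  ultimately show ?thesis unfolding open_proj_iff by metis
qed

lemma closure_affine_chart:
  assumes "bounded D"
  shows "closure (affine_chart A ` D) = affine_chart A ` closure D"
proof
  have "compact (affine_chart A ` closure D)"
    using assms continuous_affine_chart
    by (intro compact_continuous_image) (auto intro: continuous_on_subset simp: compact_closure)
  then show "closure (affine_chart A ` D) \<subseteq> affine_chart A ` closure D"
    by (intro closure_minimal image_mono closure_subset compact_imp_closed)
  show "affine_chart A ` closure D \<subseteq> closure (affine_chart A ` D)"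
    by (rule image_closure_subset[OF continuous_on_subset[OF continuous_affine_chart]])
       (auto intro: closure_subset[THEN subsetD])
qed

end

lemma properly_open_convex_subset:
  assumes "proper_chart A C" "open U" "U \<subseteq> closure C"
  shows "U \<subseteq> C"
proof -
  obtain D where A: "linear A" "bij A" and D: "open D" "bounded D" "convex D" "C = affine_chart A ` D"
    using assms(1) unfolding proper_chart_def by blast
  have U: "U \<subseteq> affine_chart A ` closure D" using assms D closure_affine_chart[OF A] by simp
  have "open (affine_chart A -` U)"
    using assms(2) continuous_affine_chart[OF A] by (simp add: open_vimage)
  moreover have "affine_chart A -` U \<subseteq> closure D"
    using U inj_affine_chart[OF A] by (metis inj_image_subset_iff image_vimage_subset subset_trans)
  ultimately have "affine_chart A -` U \<subseteq> interior (closure D)" by (rule interior_maximal[rotated])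
  also have "\<dots> = D" using D by (simp add: convex_interior_closure interior_open)
  finally have "affine_chart A -` U \<subseteq> D" .
  then show ?thesis using U D(4) by blast
qed

lemma Metric_space_hausdorff:
  "Metric_space {C :: 'n::finite rpn set. properly_open_convex C}
     (\<lambda>C D. hausdorff_dist (closure C) (closure D))"
proof
  show "0 \<le> hausdorff_dist (closure C) (closure D)" for C D :: "'n rpn set"
    unfolding hausdorff_dist_def by (rule cInf_greatest[OF hausdorff_dist_nonempty]) auto
  show "hausdorff_dist (closure C) (closure D) = hausdorff_dist (closure D) (closure C)"
    for C D :: "'n rpn set"
    unfolding hausdorff_dist_def by (rule arg_cong[of _ _ Inf]) auto
next
  have poc: "open C" "C \<noteq> {}" if "properly_open_convex C" for C :: "'n rpn set"
    using that open_affine_chart unfolding properly_open_convex_def proper_chart_def by auto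
  have sub: "C \<subseteq> D" if C: "properly_open_convex C" and D: "properly_open_convex D"
    and z: "hausdorff_dist (closure C) (closure D) = 0" for C D :: "'n rpn set"
  proof -
    have "closure C \<subseteq> closure D"
    proof
      fix x assume x: "x \<in> closure C"
      have "infdist x (closure D) < e" if "e > 0" for e
        using hausdorff_dist_lessD(1)[OF _ x] z that by auto
      then have "infdist x (closure D) = 0"
        using infdist_nonneg[of x "closure D"] by (metis less_irrefl order_less_le)
      then show "x \<in> closure D"
        using poc[OF D] by (simp add: in_closed_iff_infdist_zero)
    qed
    then have "C \<subseteq> closure D" using closure_subset by blast
    then show ?thesis using properly_open_convex_subset poc(1)[OF C] D
      unfolding properly_open_convex_def by blast
  qed
  fix C D :: "'n rpn set"
  assume "C \<in> {C. properly_open_convex C}" "D \<in> {C. properly_open_convex C}"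
  then have CD: "properly_open_convex C" "properly_open_convex D" by auto
  have comm: "hausdorff_dist (closure C) (closure D) = hausdorff_dist (closure D) (closure C)"
    unfolding hausdorff_dist_def by (rule arg_cong[of _ _ Inf]) auto
  have "hausdorff_dist (closure C) (closure C) = 0"
  proof (rule antisym)
    show "hausdorff_dist (closure C) (closure C) \<le> 0" by (rule hausdorff_dist_le) auto
    show "0 \<le> hausdorff_dist (closure C) (closure C)"
      unfolding hausdorff_dist_def by (rule cInf_greatest[OF hausdorff_dist_nonempty]) auto
  qed
  then show "hausdorff_dist (closure C) (closure D) = 0 \<longleftrightarrow> C = D"
    using sub CD comm by (metis subset_antisym)
  fix E assume "E \<in> {C :: 'n rpn set. properly_open_convex C}"
  then have E: "properly_open_convex E" by auto
  have tri: "infdist x (closure E) \<le> infdist x (closure D) + e"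
    if "\<forall>y\<in>closure D. infdist y (closure E) \<le> e" "properly_open_convex D"
    for x e and D E :: "'n rpn set"
  proof -
    have "infdist x (closure E) \<le> infdist x (closure D) + e + \<epsilon>" if \<epsilon>: "\<epsilon> > 0" for \<epsilon>
    proof -
      have "(INF y\<in>closure D. dist x y) < infdist x (closure D) + \<epsilon>"
        using poc[OF \<open>properly_open_convex D\<close>] \<epsilon> by (simp add: infdist_notempty)
      then obtain y where y: "y \<in> closure D" "dist x y < infdist x (closure D) + \<epsilon>"
        using poc(2)[OF \<open>properly_open_convex D\<close>] by (auto simp: cINF_less_iff)
      have "infdist x (closure E) \<le> infdist y (closure E) + dist x y" by (rule infdist_triangle)
      then show ?thesis using y \<open>\<forall>y\<in>closure D. infdist y (closure E) \<le> e\<close> by fastforce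
    qed
    then show ?thesis by (rule field_le_epsilon)
  qed
  show "hausdorff_dist (closure C) (closure E) \<le>
      hausdorff_dist (closure C) (closure D) + hausdorff_dist (closure D) (closure E)"
  proof (rule field_le_epsilon)
    fix \<epsilon> :: real assume "\<epsilon> > 0"
    define s where "s = hausdorff_dist (closure C) (closure D) + \<epsilon> / 2"
    define t where "t = hausdorff_dist (closure D) (closure E) + \<epsilon> / 2"
    have s: "hausdorff_dist (closure C) (closure D) < s" using \<open>\<epsilon> > 0\<close> by (simp add: s_def)
    have t: "hausdorff_dist (closure D) (closure E) < t" using \<open>\<epsilon> > 0\<close> by (simp add: t_def)
    note S = hausdorff_dist_lessD[OF s] and T = hausdorff_dist_lessD[OF t]
    obtain z where "z \<in> closure C" using poc(2)[OF CD(1)] closure_subset by blast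
    then have s0: "0 \<le> s" using S(1) infdist_nonneg by (metis less_imp_le order_trans)
    obtain z where "z \<in> closure D" using poc(2)[OF CD(2)] closure_subset by blast
    then have t0: "0 \<le> t" using T(1) infdist_nonneg by (metis less_imp_le order_trans)
    have "hausdorff_dist (closure C) (closure E) \<le> s + t"
    proof (rule hausdorff_dist_le)
      fix x assume "x \<in> closure C"
      then show "infdist x (closure E) \<le> s + t"
        using S(1) tri[of D E t x] T(1) CD by (smt (verit))
    next
      fix x assume "x \<in> closure E"
      then show "infdist x (closure C) \<le> s + t"
        using T(2) tri[of D C s x] S(2) CD by (smt (verit))
    qed (use s0 t0 in auto)
    then show "hausdorff_dist (closure C) (closure E) \<le>
      hausdorff_dist (closure C) (closure D) + hausdorff_dist (closure D) (closure E) + \<epsilon>"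
      by (simp add: s_def t_def)
  qed
qed


section \<open>The Hilbert distance\<close>

definition affine_hilbert_dist :: "'v::real_normed_vector set \<Rightarrow> 'v \<Rightarrow> 'v \<Rightarrow> real" where
  "affine_hilbert_dist D p q =
     (if p = q then 0
      else (THE d. \<exists>a\<in>frontier D. \<exists>b\<in>frontier D.
              p \<in> open_segment a q \<and> q \<in> open_segment p b \<and>
              d = 1 / 2 * ln ((norm (q - a) / norm (p - a)) * (norm (p - b) / norm (q - b)))))"

text \<open>The cross-ratio is projectively invariant, so the choice of the chart is immaterial.\<close>
definition hilbert_dist :: "'n::finite rpn set \<Rightarrow> 'n rpn \<Rightarrow> 'n rpn \<Rightarrow> real" where
  "hilbert_dist C P Q =
     (let \<phi> = affine_chart (SOME A. proper_chart A C)
      in affine_hilbert_dist (\<phi> -` C) (inv \<phi> P) (inv \<phi> Q))"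


section \<open>Amenability\<close>

text \<open>The first two arguments are a carrier set and a metric on it.\<close>

definition separated_net :: "'a set \<Rightarrow> ('a \<Rightarrow> 'a \<Rightarrow> real) \<Rightarrow> 'a set \<Rightarrow> bool" where
  "separated_net M d X \<longleftrightarrow>
     (\<exists>r>0. X \<subseteq> M \<and> (\<forall>x\<in>X. \<forall>y\<in>X. x \<noteq> y \<longrightarrow> d x y \<ge> r) \<and>
        (\<forall>Y. X \<subseteq> Y \<and> Y \<subseteq> M \<and> (\<forall>x\<in>Y. \<forall>y\<in>Y. x \<noteq> y \<longrightarrow> d x y \<ge> r) \<longrightarrow> Y = X))"

definition bounded_perturbation ::
    "('a \<Rightarrow> 'a \<Rightarrow> real) \<Rightarrow> 'a set \<Rightarrow> 'a set \<Rightarrow> 'a set \<Rightarrow> ('a \<Rightarrow> 'a) \<Rightarrow> bool" where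
  "bounded_perturbation d X S T \<gamma> \<longleftrightarrow>
     S \<subseteq> X \<and> T \<subseteq> X \<and> bij_betw \<gamma> S T \<and> bdd_above ((\<lambda>x. d (\<gamma> x) x) ` S)"

definition amenable_pseudogroup :: "('a \<Rightarrow> 'a \<Rightarrow> real) \<Rightarrow> 'a set \<Rightarrow> bool" where
  "amenable_pseudogroup d X \<longleftrightarrow>
     (\<exists>\<mu> :: 'a set \<Rightarrow> real. \<mu> \<in> Pow X \<rightarrow> {0..1} \<and> additive (Pow X) \<mu> \<and> \<mu> X = 1 \<and>
        (\<forall>S T \<gamma>. bounded_perturbation d X S T \<gamma> \<longrightarrow> \<mu> S = \<mu> T))"

definition amenable :: "'a set \<Rightarrow> ('a \<Rightarrow> 'a \<Rightarrow> real) \<Rightarrow> bool" where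
  "amenable M d \<longleftrightarrow> (\<exists>X. separated_net M d X \<and> amenable_pseudogroup d X)"

end

theory Submission
  imports Defs
begin

text \<open>Logarithms of the affine functions cutting out a polytope embed its Hilbert geometry into a
  finite-dimensional normed space, so its balls have polynomial growth, with a degree and constants
  that survive small perturbations: if a projective image of \<open>C\<close> is squeezed between slightly shrunken
  and slightly enlarged copies of the polytope, then separated subsets of a ball of radius \<open>\<rho>\<close> in \<open>C\<close>,
  for a suitable centre, have at most polynomially many points in \<open>\<rho>\<close>. As \<open>C\<close> is \<open>G\<close>-polygonal, this is
  available for every \<open>\<rho>\<close>. Polynomial growth along such balls yields Folner sets in a separated net, and
  a cluster point of the normalised counting measures of Folner sets is the invariant mean.\<close>

section \<open>The Hilbert distance through affine functions\<close>

text \<open>The obstacle is that growth does not simply pass to the limit. A projective image of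
  \<open>C\<close> matches the polytope only up to an error \<delta>, and close to the boundary any
  fixed error ruins the logarithms of the facet functions. However, a function positive on the
  domain, normalised by the height of the lift, shrinks at most by the factor
  \<open>exp (2 * \<rho>)\<close> between the centre and a point at distance \<rho>, so an error of
  order \<open>exp (- 2 * \<rho>)\<close> is harmless on that ball. Hence the projective image, and
  with it the centre, varies with \<rho>, whereas degree and constants come from the polytope alone.
  Two families of functionals share the work. Facets moved outwards are positive on the domain and
  bound distances from below; of the facets moved inwards, at least one is nonpositive at each
  frontier point, and they bound distances from above. Distances are always computed in the original
  chart of \<open>C\<close>: the functionals are pulled back to it along a linear lift
  \<open>S\<close>.\<close>

lemma hilbert_endpoint_exists:
  fixes D :: "'a::euclidean_space set"
  assumes "open D" "bounded D" "q \<in> D" "p \<noteq> q"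
  obtains b where "b \<in> frontier D" "q \<in> open_segment p b"
proof -
  have "q \<in> interior D" using assms by (simp add: interior_open)
  then obtain d where d: "0 < d" "q + d *\<^sub>R (q - p) \<in> frontier D"
    using ray_to_frontier[of D q "q - p"] assms by auto
  \<comment> \<open>On the ray, \<open>q - p\<close> is one part out of the \<open>1 + d\<close>
    parts between \<open>p\<close> and the exit point.\<close>
  have "q = (1 - 1 / (1 + d)) *\<^sub>R p + (1 / (1 + d)) *\<^sub>R (q + d *\<^sub>R (q - p))"
  proof -
    have "1 - 1 / (1 + d) = (1 / (1 + d)) * d" using d by (simp add: field_simps)
    then have "(1 - 1 / (1 + d)) *\<^sub>R p + (1 / (1 + d)) *\<^sub>R (q + d *\<^sub>R (q - p))
        = (1 / (1 + d)) *\<^sub>R (d *\<^sub>R p + (q + d *\<^sub>R (q - p)))"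
      by (simp add: scaleR_right_distrib)
    also have "d *\<^sub>R p + (q + d *\<^sub>R (q - p)) = (1 + d) *\<^sub>R q"
      by (simp add: algebra_simps)
    finally show ?thesis using d by simp
  qed
  moreover have "p \<noteq> q + d *\<^sub>R (q - p)"
  proof
    assume "p = q + d *\<^sub>R (q - p)"
    then have "(1 + d) *\<^sub>R (q - p) = 0" by (simp add: algebra_simps)
    then show False using d assms by simp
  qed
  ultimately have "q \<in> open_segment p (q + d *\<^sub>R (q - p))"
    unfolding in_segment using d by (intro conjI exI[of _ "1 / (1 + d)"]) auto
  then show thesis using that d by blast
qed

text \<open>Of two exit points on one ray from \<open>p\<close>, the nearer would lie strictly
  between an interior point and a point of the closure, hence in the interior. This makes the
  definite description in \<open>affine_hilbert_dist\<close> well defined.\<close>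

lemma hilbert_endpoint_unique:
  fixes D :: "'a::euclidean_space set"
  assumes "open D" "convex D" "p \<in> D" "b \<in> frontier D" "b' \<in> frontier D"
    "q \<in> open_segment p b" "q \<in> open_segment p b'"
  shows "b = b'"
proof -
  obtain s where s: "0 < s" "s < 1" "q = (1 - s) *\<^sub>R p + s *\<^sub>R b"
    using assms(6) by (auto simp: in_segment)
  obtain t where t: "0 < t" "t < 1" "q = (1 - t) *\<^sub>R p + t *\<^sub>R b'"
    using assms(7) by (auto simp: in_segment)
  have *: "s *\<^sub>R (b - p) = t *\<^sub>R (b' - p)" using s(3) t(3) by (simp add: algebra_simps)
  have False if "s < t" "0 < s" "c \<in> frontier D" "c' \<in> frontier D" "s *\<^sub>R (c - p) = t *\<^sub>R (c' - p)"
    for s t c c'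
  proof -
    have "c' - p = (1 / t) *\<^sub>R (t *\<^sub>R (c' - p))" using that(1,2) by simp
    then have "c' - p = (s / t) *\<^sub>R (c - p)" unfolding that(5)[symmetric] by simp
    then have "c' = (1 - s / t) *\<^sub>R p + (s / t) *\<^sub>R c" by (simp add: algebra_simps)
    moreover have "p \<noteq> c" using that assms by (auto simp: frontier_def interior_open)
    ultimately have "c' \<in> open_segment p c"
      unfolding in_segment using that by (intro conjI exI[of _ "s / t"]) auto
    then have "c' \<in> interior D"
      using in_interior_closure_convex_segment[of D p c] assms that
      by (auto simp: frontier_def interior_open)
    then show False using that by (auto simp: frontier_def)
  qed
  from this[of s t b b'] this[of t s b' b] have "s = t" using s t * assms
    by (metis linorder_neqE_linordered_idom)
  then show ?thesis using * s by simp
qed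

text \<open>Replaces the norm quotients by barycentric parameters, which affine functions can be
  evaluated against: \<open>p - a\<close> is \<open>s\<close> times \<open>q - a\<close>, and
  \<open>q - b\<close> is \<open>t\<close> times \<open>p - b\<close>.\<close>

lemma affine_hilbert_dist_endpoints:
  fixes D :: "'a::euclidean_space set"
  assumes "open D" "bounded D" "convex D" "p \<in> D" "q \<in> D" "p \<noteq> q"
  obtains a b s t where "a \<in> frontier D" "b \<in> frontier D" "0 < s" "s < 1" "0 < t" "t < 1"
    "p = (1 - s) *\<^sub>R a + s *\<^sub>R q" "q = (1 - t) *\<^sub>R b + t *\<^sub>R p"
    "affine_hilbert_dist D p q = 1 / 2 * ln (1 / s * (1 / t))"
proof -
  obtain a where a: "a \<in> frontier D" "p \<in> open_segment q a"
    using hilbert_endpoint_exists[of D p q] assms by metis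
  obtain b where b: "b \<in> frontier D" "q \<in> open_segment p b"
    using hilbert_endpoint_exists[of D q p] assms by metis
  have p: "p \<in> open_segment a q" using a by (simp add: open_segment_commute)
  have d: "affine_hilbert_dist D p q =
      1 / 2 * ln ((norm (q - a) / norm (p - a)) * (norm (p - b) / norm (q - b)))"
    unfolding affine_hilbert_dist_def using assms(6)
  proof (simp only: if_False, intro the_equality)
    show "\<exists>a'\<in>frontier D. \<exists>b'\<in>frontier D. p \<in> open_segment a' q \<and> q \<in> open_segment p b' \<and>
        1 / 2 * ln (norm (q - a) / norm (p - a) * (norm (p - b) / norm (q - b))) =
        1 / 2 * ln (norm (q - a') / norm (p - a') * (norm (p - b') / norm (q - b')))"
      using a b p by blast
  next
    fix d assume "\<exists>a\<in>frontier D. \<exists>b\<in>frontier D. p \<in> open_segment a q \<and> q \<in> open_segment p b \<and>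
        d = 1 / 2 * ln (norm (q - a) / norm (p - a) * (norm (p - b) / norm (q - b)))"
    then obtain a' b' where *: "a' \<in> frontier D" "b' \<in> frontier D" "p \<in> open_segment a' q"
      "q \<in> open_segment p b'"
      "d = 1 / 2 * ln (norm (q - a') / norm (p - a') * (norm (p - b') / norm (q - b')))" by blast
    have "a' = a" using hilbert_endpoint_unique[of D q a' a p] assms * a
      by (simp add: open_segment_commute)
    moreover have "b' = b" using hilbert_endpoint_unique[of D p b' b q] assms * b by simp
    ultimately show "d = 1 / 2 * ln (norm (q - a) / norm (p - a) * (norm (p - b) / norm (q - b)))"
      using * by simp
  qed
  obtain s where s: "0 < s" "s < 1" "p = (1 - s) *\<^sub>R a + s *\<^sub>R q"
    using p by (auto simp: in_segment)
  obtain t where t: "0 < t" "t < 1" "q = (1 - t) *\<^sub>R b + t *\<^sub>R p"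
    using b(2) by (subst (asm) open_segment_commute) (auto simp: in_segment)
  have "p - a = s *\<^sub>R (q - a)" using s(3) by (simp add: algebra_simps)
  then have 1: "norm (q - a) / norm (p - a) = 1 / s"
    using s a assms by (auto simp: frontier_def interior_open)
  have "q - b = t *\<^sub>R (p - b)" using t(3) by (simp add: algebra_simps)
  then have 2: "norm (p - b) / norm (q - b) = 1 / t"
    using t b assms by (auto simp: frontier_def interior_open)
  show thesis using that[OF a(1) b(1) s(1,2) t(1,2) s(3) t(3)] d 1 2 by simp
qed

text \<open>Linear functionals on \<open>'a \<times> real\<close>, restricted to height 1, are the affine functions; a
  functional can be moved between charts without tracking the scaling of the lifts.\<close>

definition cone_dual :: "'a::euclidean_space set \<Rightarrow> ('a \<times> real \<Rightarrow> real) set" where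
  "cone_dual D = {L. linear L \<and> (\<forall>x\<in>D. L (x, 1) > 0)}"

lemma linear_height_one_segment:
  assumes "linear (L :: 'a::real_vector \<times> real \<Rightarrow> real)"
  shows "L ((1 - s) *\<^sub>R x + s *\<^sub>R y, 1) = (1 - s) * L (x, 1) + s * L (y, 1)"
proof -
  have "((1 - s) *\<^sub>R x + s *\<^sub>R y, 1) = (1 - s) *\<^sub>R (x, 1::real) + s *\<^sub>R (y, 1)" by simp
  then show ?thesis
    by (simp only: linear_add[OF assms] linear_cmul[OF assms] real_scaleR_def)
qed

lemma linear_height_one_closure:
  fixes D :: "'a::euclidean_space set"
  assumes "linear (L :: 'a \<times> real \<Rightarrow> real)" "\<And>x. x \<in> D \<Longrightarrow> L (x, 1) \<ge> 0" "a \<in> closure D"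
  shows "L (a, 1) \<ge> 0"
proof -
  have "continuous_on (closure D) (\<lambda>x. L (x, 1))"
    using linear_continuous_on_compose[OF _ assms(1), of "closure D" "\<lambda>x. (x, 1)"]
    by (simp add: continuous_on_Pair)
  then show ?thesis using continuous_ge_on_closure[of D "\<lambda>x. L (x, 1)" a 0] assms by auto
qed

text \<open>\<open>L\<close> is nonnegative at the endpoint \<open>a\<close> behind
  \<open>p\<close>, so \<open>L (p, 1)\<close> is at least \<open>s * L (q, 1)\<close>;
  \<open>M\<close> is treated alike at \<open>b\<close> with \<open>t\<close>. This is one half of
  the formula for the Hilbert distance as a supremum over pairs of functionals.\<close>

lemma affine_hilbert_dist_lower:
  fixes D :: "'a::euclidean_space set"
  assumes D: "open D" "bounded D" "convex D" and p: "p \<in> D" and q: "q \<in> D"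
    and L: "L \<in> cone_dual D" and M: "M \<in> cone_dual D"
  shows "1 / 2 * (ln (L (q, 1) / L (p, 1)) + ln (M (p, 1) / M (q, 1))) \<le> affine_hilbert_dist D p q"
proof (cases "p = q")
  case True
  have "L (q, 1) > 0" "M (q, 1) > 0" using L M q by (auto simp: cone_dual_def)
  then show ?thesis using True by (simp add: affine_hilbert_dist_def)
next
  case False
  obtain a b s t where *: "a \<in> frontier D" "b \<in> frontier D" "0 < s" "s < 1" "0 < t" "t < 1"
    "p = (1 - s) *\<^sub>R a + s *\<^sub>R q" "q = (1 - t) *\<^sub>R b + t *\<^sub>R p"
    "affine_hilbert_dist D p q = 1 / 2 * ln (1 / s * (1 / t))"
    using affine_hilbert_dist_endpoints[OF D p q False] .
  have lin: "linear L" "linear M" using L M by (auto simp: cone_dual_def)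
  have pos: "L (p, 1) > 0" "L (q, 1) > 0" "M (p, 1) > 0" "M (q, 1) > 0"
    using L M p q by (auto simp: cone_dual_def)
  have "L (a, 1) \<ge> 0" "M (b, 1) \<ge> 0"
    using linear_height_one_closure[OF lin(1), of D a] linear_height_one_closure[OF lin(2), of D b]
      L M *(1,2) by (auto simp: cone_dual_def frontier_def less_imp_le)
  moreover have "L (p, 1) = (1 - s) * L (a, 1) + s * L (q, 1)"
    by (subst *(7)) (rule linear_height_one_segment[OF lin(1)])
  moreover have "M (q, 1) = (1 - t) * M (b, 1) + t * M (p, 1)"
    by (subst *(8)) (rule linear_height_one_segment[OF lin(2)])
  ultimately have "s * L (q, 1) \<le> L (p, 1)" "t * M (p, 1) \<le> M (q, 1)"
    using *(3-6) by auto
  then have "L (q, 1) / L (p, 1) \<le> 1 / s" "M (p, 1) / M (q, 1) \<le> 1 / t"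
    using pos *(3-6) by (auto simp: field_simps)
  then have "ln (L (q, 1) / L (p, 1)) \<le> ln (1 / s)" "ln (M (p, 1) / M (q, 1)) \<le> ln (1 / t)"
    using pos *(3-6) by auto
  then show ?thesis using *(3-6,9) by (simp add: ln_mult ln_div)
qed

lemma affine_hilbert_dist_upper:
  fixes D :: "'a::euclidean_space set" and \<L> :: "('a \<times> real \<Rightarrow> real) set"
  assumes D: "open D" "bounded D" "convex D" and p: "p \<in> D" and q: "q \<in> D" "p \<noteq> q"
    and lin: "\<And>L. L \<in> \<L> \<Longrightarrow> linear L"
    and pos: "\<And>L. L \<in> \<L> \<Longrightarrow> L (p, 1) > 0" "\<And>L. L \<in> \<L> \<Longrightarrow> L (q, 1) > 0"
    and fr: "\<And>a. a \<in> frontier D \<Longrightarrow> \<exists>L\<in>\<L>. L (a, 1) \<le> 0"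
  obtains L M where "L \<in> \<L>" "M \<in> \<L>"
    "affine_hilbert_dist D p q \<le> 1 / 2 * (ln (L (q, 1) / L (p, 1)) + ln (M (p, 1) / M (q, 1)))"
proof -
  obtain a b s t where *: "a \<in> frontier D" "b \<in> frontier D" "0 < s" "s < 1" "0 < t" "t < 1"
    "p = (1 - s) *\<^sub>R a + s *\<^sub>R q" "q = (1 - t) *\<^sub>R b + t *\<^sub>R p"
    "affine_hilbert_dist D p q = 1 / 2 * ln (1 / s * (1 / t))"
    using affine_hilbert_dist_endpoints[OF D p q] .
  obtain L where L: "L \<in> \<L>" "L (a, 1) \<le> 0" using fr *(1) by blast
  obtain M where M: "M \<in> \<L>" "M (b, 1) \<le> 0" using fr *(2) by blast
  have "L (p, 1) = (1 - s) * L (a, 1) + s * L (q, 1)"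
    by (subst *(7)) (rule linear_height_one_segment[OF lin[OF L(1)]])
  moreover have "M (q, 1) = (1 - t) * M (b, 1) + t * M (p, 1)"
    by (subst *(8)) (rule linear_height_one_segment[OF lin[OF M(1)]])
  ultimately have "L (p, 1) \<le> s * L (q, 1)" "M (q, 1) \<le> t * M (p, 1)"
    using *(3-6) L M by (auto simp: mult_nonneg_nonpos)
  then have "1 / s \<le> L (q, 1) / L (p, 1)" "1 / t \<le> M (p, 1) / M (q, 1)"
    using pos L M *(3-6) by (auto simp: field_simps)
  then have "ln (1 / s) \<le> ln (L (q, 1) / L (p, 1))" "ln (1 / t) \<le> ln (M (p, 1) / M (q, 1))"
    using pos L M *(3-6) by (auto intro!: ln_mono divide_pos_pos)
  then have "affine_hilbert_dist D p q \<le> 1 / 2 * (ln (L (q, 1) / L (p, 1)) + ln (M (p, 1) / M (q, 1)))"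
    using *(3-6,9) by (simp add: ln_mult ln_div)
  then show thesis using that L M by blast
qed

section \<open>The supremum formula and the metric axioms\<close>

lemma supporting_functional:
  fixes D :: "'a::euclidean_space set"
  assumes "open D" "convex D" "D \<noteq> {}" "a \<notin> D"
  obtains L where "L \<in> cone_dual D" "L (a, 1) = 0"
proof -
  obtain u c where u: "u \<noteq> 0" "u \<bullet> a \<le> c" "\<And>x. x \<in> D \<Longrightarrow> c \<le> u \<bullet> x"
    using separating_hyperplane_sets[of "{a}" D] assms by auto
  define L where "L = (\<lambda>v::'a \<times> real. u \<bullet> fst v - (u \<bullet> a) * snd v)"
  have "linear L" unfolding L_def
    by (intro linearI) (auto simp: inner_add_right algebra_simps)
  moreover have "u \<bullet> x > u \<bullet> a" if x: "x \<in> D" for x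
  proof -
    obtain e where e: "e > 0" "ball x e \<subseteq> D" using assms(1) x open_contains_ball by blast
    \<comment> \<open>A shift of length \<open>e / 2\<close> against \<open>u\<close> stays in the
      ball; it turns weak separation into strict positivity.\<close>
    have "x - (e / 2 / norm u) *\<^sub>R u \<in> D" using e u by (intro subsetD[OF e(2)]) (auto simp: dist_norm)
    then have "c \<le> u \<bullet> (x - (e / 2 / norm u) *\<^sub>R u)" by (rule u)
    also have "\<dots> < u \<bullet> x" using e u by (auto simp: inner_diff_right)
    finally show ?thesis using u by simp
  qed
  ultimately have "L \<in> cone_dual D" by (auto simp: cone_dual_def L_def)
  then show thesis using that[of L] by (simp add: L_def)
qed

lemma affine_hilbert_dist_attained:
  fixes D :: "'a::euclidean_space set"
  assumes D: "open D" "bounded D" "convex D" and p: "p \<in> D" and q: "q \<in> D"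
  obtains L M where "L \<in> cone_dual D" "M \<in> cone_dual D"
    "affine_hilbert_dist D p q \<le> 1 / 2 * (ln (L (q, 1) / L (p, 1)) + ln (M (p, 1) / M (q, 1)))"
proof (cases "p = q")
  case True
  have "snd \<in> cone_dual D" by (simp add: cone_dual_def linear_snd)
  then show thesis using that[of snd snd] True by (simp add: affine_hilbert_dist_def)
next
  case False
  show thesis
  proof (rule affine_hilbert_dist_upper[OF D p q False, of "cone_dual D"])
    fix a assume "a \<in> frontier D"
    then have "a \<notin> D" using D by (simp add: frontier_def interior_open)
    then show "\<exists>L\<in>cone_dual D. L (a, 1) \<le> 0"
      using supporting_functional[of D a] D p by (metis empty_iff order_refl)
  qed (use p q that in \<open>auto simp: cone_dual_def\<close>)
qed

text \<open>Exchanging \<open>p\<close> and \<open>q\<close> in the supremum amounts to exchanging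
  \<open>L\<close> and \<open>M\<close>.\<close>

lemma affine_hilbert_dist_commute:
  fixes D :: "'a::euclidean_space set"
  assumes D: "open D" "bounded D" "convex D" and p: "p \<in> D" and q: "q \<in> D"
  shows "affine_hilbert_dist D p q = affine_hilbert_dist D q p"
proof -
  have "affine_hilbert_dist D p q \<le> affine_hilbert_dist D q p" if pq: "p \<in> D" "q \<in> D" for p q
  proof -
    obtain L M where "L \<in> cone_dual D" "M \<in> cone_dual D"
      "affine_hilbert_dist D p q \<le> 1 / 2 * (ln (L (q, 1) / L (p, 1)) + ln (M (p, 1) / M (q, 1)))"
      using affine_hilbert_dist_attained[OF D pq] .
    then show ?thesis using affine_hilbert_dist_lower[OF D pq(2,1), of M L] by simp
  qed
  then show ?thesis using p q by (simp add: order_antisym)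
qed

text \<open>For a fixed pair of functionals the logarithmic expression is additive along
  \<open>p\<close>, \<open>q\<close>, \<open>r\<close>; the pair attaining the distance from
  \<open>p\<close> to \<open>r\<close> then bounds the other two distances from below.\<close>

lemma affine_hilbert_dist_triangle:
  fixes D :: "'a::euclidean_space set"
  assumes D: "open D" "bounded D" "convex D" and p: "p \<in> D" and q: "q \<in> D" and r: "r \<in> D"
  shows "affine_hilbert_dist D p r \<le> affine_hilbert_dist D p q + affine_hilbert_dist D q r"
proof -
  obtain L M where LM: "L \<in> cone_dual D" "M \<in> cone_dual D"
    "affine_hilbert_dist D p r \<le> 1 / 2 * (ln (L (r, 1) / L (p, 1)) + ln (M (p, 1) / M (r, 1)))"
    using affine_hilbert_dist_attained[OF D p r] .
  have pos: "K (x, 1) > 0" if "K \<in> cone_dual D" "x \<in> D" for K x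
    using that by (auto simp: cone_dual_def)
  note pos = pos[OF LM(1) p] pos[OF LM(1) q] pos[OF LM(1) r]
    pos[OF LM(2) p] pos[OF LM(2) q] pos[OF LM(2) r]
  show ?thesis
    using affine_hilbert_dist_lower[OF D p q LM(1,2)] affine_hilbert_dist_lower[OF D q r LM(1,2)] LM(3) pos
    by (simp add: ln_div)
qed

section \<open>Folner sets and invariant means\<close>

lemma maximal_separated_exists:
  fixes d :: "'a \<Rightarrow> 'a \<Rightarrow> real"
  obtains X where "X \<subseteq> M" "\<forall>x\<in>X. \<forall>y\<in>X. x \<noteq> y \<longrightarrow> d x y \<ge> r"
    "\<forall>Y. X \<subseteq> Y \<and> Y \<subseteq> M \<and> (\<forall>x\<in>Y. \<forall>y\<in>Y. x \<noteq> y \<longrightarrow> d x y \<ge> r) \<longrightarrow> Y = X"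
proof -
  define \<A> where "\<A> = {X. X \<subseteq> M \<and> (\<forall>x\<in>X. \<forall>y\<in>X. x \<noteq> y \<longrightarrow> d x y \<ge> r)}"
  have "\<exists>X\<in>\<A>. \<forall>Y\<in>\<A>. X \<subseteq> Y \<longrightarrow> Y = X"
  proof (rule subset_Zorn')
    fix \<C> assume C: "subset.chain \<A> \<C>"
    have "d x y \<ge> r" if xy: "x \<in> \<Union>\<C>" "y \<in> \<Union>\<C>" "x \<noteq> y" for x y
    proof -
      obtain A B where AB: "x \<in> A" "y \<in> B" "A \<in> \<C>" "B \<in> \<C>" using xy(1,2) by blast
      then have "A \<subseteq> B \<or> B \<subseteq> A" "A \<in> \<A>" "B \<in> \<A>"
        using C by (auto simp: subset_chain_def)
      then show ?thesis using AB xy(3) unfolding \<A>_def by blast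
    qed
    moreover have "\<Union>\<C> \<subseteq> M" using C by (auto simp: subset_chain_def \<A>_def)
    ultimately show "\<Union>\<C> \<in> \<A>" by (auto simp: \<A>_def)
  qed
  then obtain X where "X \<in> \<A>" "\<forall>Y\<in>\<A>. X \<subseteq> Y \<longrightarrow> Y = X" by blast
  then show thesis by (intro that[of X]) (simp_all add: \<A>_def)
qed

text \<open>The cube is compact by Tychonoff, so the closures of the tails have a common point. In
  this form every closed condition that holds eventually passes to \<open>m\<close>, which does the
  work of an ultrafilter limit.\<close>

lemma cluster_point_unit_cube:
  fixes \<mu> :: "nat \<Rightarrow> 'i \<Rightarrow> real"
  assumes "\<And>n i. \<mu> n i \<in> {0..1}"
  shows "\<exists>m. \<forall>n C. closed C \<and> (\<forall>k\<ge>n. \<mu> k \<in> C) \<longrightarrow> m \<in> C"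
proof -
  define S where "S = (PiE UNIV (\<lambda>_. {0..1}) :: ('i \<Rightarrow> real) set)"
  have "compactin (product_topology (\<lambda>_. euclidean) UNIV) S"
    unfolding S_def by (subst compactin_PiE) auto
  then have S: "compact S" by (simp add: euclidean_product_topology)
  have "S \<inter> \<Inter>(range (\<lambda>n. closure (\<mu> ` {n..}))) \<noteq> {}"
  proof (rule compact_imp_fip[OF S])
    fix F assume "finite F" "F \<subseteq> range (\<lambda>n. closure (\<mu> ` {n..}))"
    then obtain N where N: "finite N" "F = (\<lambda>n. closure (\<mu> ` {n..})) ` N"
      by (meson finite_subset_image)
    have k: "n \<le> Max N" if "n \<in> N" for n using N(1) that by simp
    have "\<mu> (Max N) \<in> closure (\<mu> ` {n..})" if "n \<in> N" for n
      using k[OF that] by (intro closure_subset[THEN subsetD]) auto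
    moreover have "\<mu> (Max N) \<in> S" using assms by (auto simp: S_def)
    ultimately show "S \<inter> \<Inter>F \<noteq> {}" using N by auto
  qed auto
  then obtain m where m: "\<And>n. m \<in> closure (\<mu> ` {n..})" by auto
  have "m \<in> C" if "closed C" "\<And>k. k \<ge> n \<Longrightarrow> \<mu> k \<in> C" for n C
    using closure_minimal[of "\<mu> ` {n..}" C] that m[of n] by auto
  then show ?thesis by blast
qed

lemma amenable_pseudogroup_Folner:
  fixes d :: "'a \<Rightarrow> 'a \<Rightarrow> real"
  assumes sym: "\<And>x y. x \<in> X \<Longrightarrow> y \<in> X \<Longrightarrow> d x y = d y x"
    and Folner: "\<And>R e. R > 0 \<Longrightarrow> e > 0 \<Longrightarrow> \<exists>F N. finite F \<and> F \<noteq> {} \<and> F \<subseteq> X \<and> finite N \<and> F \<subseteq> N \<and>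
      real (card N) \<le> (1 + e) * real (card F) \<and> (\<forall>x\<in>X. \<forall>y\<in>F. d x y \<le> R \<longrightarrow> x \<in> N)"
  shows "amenable_pseudogroup d X"
proof -
  have "\<exists>F N. finite F \<and> F \<noteq> {} \<and> F \<subseteq> X \<and> finite N \<and> F \<subseteq> N \<and>
      real (card N) \<le> (1 + 1 / real (Suc n)) * real (card F) \<and>
      (\<forall>x\<in>X. \<forall>y\<in>F. d x y \<le> real (Suc n) \<longrightarrow> x \<in> N)" for n
    by (rule Folner) auto
  then obtain F N where F: "\<And>n. finite (F n)" "\<And>n. F n \<noteq> {}" "\<And>n. F n \<subseteq> X"
    and N: "\<And>n. finite (N n)" "\<And>n. F n \<subseteq> N n"
      "\<And>n. real (card (N n)) \<le> (1 + 1 / real (Suc n)) * real (card (F n))"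
      "\<And>n x y. x \<in> X \<Longrightarrow> y \<in> F n \<Longrightarrow> d x y \<le> real (Suc n) \<Longrightarrow> x \<in> N n"
    by metis
  define \<mu> where "\<mu> n S = real (card (S \<inter> F n)) / real (card (F n))" for n S
  have pos: "real (card (F n)) > 0" for n using F by (simp add: card_gt_0_iff)
  have mu01: "\<mu> n S \<in> {0..1}" for n S
    using F(1)[of n] by (auto simp: \<mu>_def divide_le_eq_1 card_mono card_gt_0_iff)
  obtain m where "\<forall>n C. closed C \<and> (\<forall>k\<ge>n. \<mu> k \<in> C) \<longrightarrow> m \<in> C"
    using cluster_point_unit_cube[of \<mu>, OF mu01] by (rule exE)
  then have m: "m \<in> C" if "closed C" "\<And>k. k \<ge> n \<Longrightarrow> \<mu> k \<in> C" for n C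
    using that by blast
  have cont [continuous_intros]: "continuous_on UNIV (\<lambda>f :: 'a set \<Rightarrow> real. f S)" for S
    by (rule continuous_on_product_coordinates)
  have m01: "m S \<in> {0..1}" for S
  proof -
    have "m \<in> {f. 0 \<le> f S} \<inter> {f. f S \<le> 1}"
      by (rule m[of _ 0], intro closed_Int closed_Collect_le continuous_intros)
         (use mu01 in auto)
    then show ?thesis by simp
  qed
  have madd: "m (S \<union> T) = m S + m T" if "S \<inter> T = {}" for S T
  proof -
    have "m \<in> {f. f (S \<union> T) = f S + f T}"
    proof (rule m[of _ 0], intro closed_Collect_eq continuous_intros)
      fix k
      have "card ((S \<union> T) \<inter> F k) = card (S \<inter> F k) + card (T \<inter> F k)"
        using that F(1)[of k] by (subst card_Un_disjoint[symmetric]) (auto simp: Int_Un_distrib2)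
      then show "\<mu> k \<in> {f. f (S \<union> T) = f S + f T}" by (simp add: \<mu>_def add_divide_distrib)
    qed
    then show ?thesis by simp
  qed
  have mX: "m X = 1"
  proof -
    have "m \<in> {f. f X = 1}"
    proof (rule m[of _ 0], intro closed_Collect_eq continuous_intros)
      fix k
      have "X \<inter> F k = F k" using F(3)[of k] by blast
      then show "\<mu> k \<in> {f. f X = 1}" using pos[of k] by (simp add: \<mu>_def)
    qed
    then show ?thesis by simp
  qed
  have inv: "m S \<le> m T" if g: "S \<subseteq> X" "T \<subseteq> X" "bij_betw \<gamma> S T" "\<And>x. x \<in> S \<Longrightarrow> d (\<gamma> x) x \<le> R" for S T \<gamma> R
  proof (rule field_le_epsilon)
    fix e :: real assume "e > 0"
    obtain n1 where n1: "R \<le> real n1" using real_arch_simple by blast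
    obtain n2 where n2: "1 / real (Suc n2) < e" using \<open>e > 0\<close> by (metis nat_approx_posE)
    \<comment> \<open>A tail suffices: \<open>n1\<close> makes the displacement bound
      \<open>R\<close> at most \<open>Suc k\<close>, and \<open>n2\<close> makes the relative error
      below \<open>e\<close>.\<close>
    have "m \<in> {f. f S \<le> f T + e}"
    proof (rule m[of _ "max n1 n2"], intro closed_Collect_le continuous_intros)
      fix k assume k: "k \<ge> max n1 n2"
      \<comment> \<open>\<gamma> may leave \<open>F k\<close> but not its neighbourhood
        \<open>N k\<close>, so the count in \<open>T\<close> falls short by at most the size of
        \<open>N k - F k\<close>.\<close>
      have "\<gamma> ` (S \<inter> F k) \<subseteq> T \<inter> N k"
      proof
        fix y assume "y \<in> \<gamma> ` (S \<inter> F k)"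
        then obtain x where x: "x \<in> S" "x \<in> F k" "y = \<gamma> x" by blast
        then have "y \<in> T" using g(3) by (auto simp: bij_betw_def)
        moreover have "d y x \<le> real (Suc k)" using g(4)[OF x(1)] n1 k x(3) by simp
        ultimately show "y \<in> T \<inter> N k" using N(4)[of y x k] x g by auto
      qed
      moreover have "inj_on \<gamma> (S \<inter> F k)" using g(3) by (meson bij_betw_def inf_le1 inj_on_subset)
      ultimately have "card (S \<inter> F k) \<le> card (T \<inter> N k)" using N(1)[of k] by (intro card_inj_on_le) auto
      also have "\<dots> \<le> card ((T \<inter> F k) \<union> (N k - F k))" using N(1)[of k] F(1)[of k] by (intro card_mono) auto
      also have "\<dots> \<le> card (T \<inter> F k) + card (N k - F k)" by (rule card_Un_le)
      also have "card (N k - F k) = card (N k) - card (F k)" using N(2)[of k] F(1)[of k] by (rule card_Diff_subset[rotated])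
      finally have "real (card (S \<inter> F k)) \<le> real (card (T \<inter> F k)) + (real (card (N k)) - real (card (F k)))"
        using card_mono[OF N(1,2)[of k]] by linarith
      also have "\<dots> \<le> real (card (T \<inter> F k)) + 1 / real (Suc k) * real (card (F k))"
        using N(3)[of k] by (simp add: algebra_simps)
      finally have "\<mu> k S \<le> (real (card (T \<inter> F k)) + 1 / real (Suc k) * real (card (F k))) / real (card (F k))"
        unfolding \<mu>_def by (intro divide_right_mono) auto
      also have "\<dots> = \<mu> k T + 1 / real (Suc k)"
        using pos[of k] unfolding \<mu>_def by (subst add_divide_distrib) simp
      also have "1 / real (Suc k) \<le> 1 / real (Suc n2)" using k by (intro divide_left_mono) auto
      finally show "\<mu> k \<in> {f. f S \<le> f T + e}" using n2 by simp
    qed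
    then show "m S \<le> m T + e" by simp
  qed
  have "m S = m T" if g: "bounded_perturbation d X S T \<gamma>" for S T \<gamma>
  proof (rule antisym)
    have ST: "S \<subseteq> X" "T \<subseteq> X" "bij_betw \<gamma> S T" using g by (auto simp: bounded_perturbation_def)
    obtain R where R: "\<And>x. x \<in> S \<Longrightarrow> d (\<gamma> x) x \<le> R"
      using g by (auto simp: bounded_perturbation_def bdd_above_def)
    show "m S \<le> m T" using inv[OF ST R] .
    have b: "bij_betw (inv_into S \<gamma>) T S" using ST(3) by (rule bij_betw_inv_into)
    \<comment> \<open>By symmetry of \<open>d\<close> the inverse has the same displacement bound,
      so the inequality already proved applies in both directions.\<close>
    have "d (inv_into S \<gamma> y) y \<le> R" if y: "y \<in> T" for y
    proof -
      have i: "inv_into S \<gamma> y \<in> S" using b y by (rule bij_betw_apply)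
      have "\<gamma> (inv_into S \<gamma> y) = y" using ST(3) y by (rule bij_betw_inv_into_right)
      then show ?thesis using R[OF i] sym[of y "inv_into S \<gamma> y"] i y ST(1,2)
        by (simp add: subset_iff)
    qed
    then show "m T \<le> m S" using inv[OF ST(2,1) b] by blast
  qed
  then show ?thesis unfolding amenable_pseudogroup_def additive_def
    using m01 madd mX by (intro exI[of _ m]) auto
qed

text \<open>This is the comparison of a polynomial of degree \<open>N\<close> with
  \<open>(1 + e) ^ (k * N)\<close> after taking an \<open>N\<close>-th root.\<close>

lemma exponential_dominates_linear:
  fixes c e :: real
  assumes "e > 0"
  obtains k where "c * (real k * real N + 1) < (1 + e) ^ k"
proof -
  define x where "x = 1 / (1 + e)"
  have x: "norm x < 1" "x > 0" using assms by (auto simp: x_def)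
  have "(\<lambda>k. c * real N * (real k * x ^ k) + c * x ^ k) \<longlonglongrightarrow> c * real N * 0 + c * 0"
    by (intro tendsto_intros powser_times_n_limit_0 x LIMSEQ_power_zero)
  then have "\<forall>\<^sub>F k in sequentially. c * real N * (real k * x ^ k) + c * x ^ k < 1"
    by (intro order_tendstoD) auto
  then obtain k where k: "c * real N * (real k * x ^ k) + c * x ^ k < 1"
    by (auto simp: eventually_sequentially)
  have "c * (real k * real N + 1) * x ^ k < 1" using k by (simp add: algebra_simps)
  moreover have "x ^ k = 1 / (1 + e) ^ k" by (simp add: x_def power_one_over)
  ultimately have "c * (real k * real N + 1) < (1 + e) ^ k" using assms by (simp add: field_simps)
  then show thesis by (rule that)
qed

text \<open>The centre of the ball may depend on the radius, but the polynomial bound may not. If no ball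
  of radius \<open>j * R\<close> with \<open>j \<le> m\<close> were a Folner set, the balls would grow exponentially in \<open>j\<close>.\<close>

lemma Folner_of_polynomial_growth:
  fixes d :: "'a \<Rightarrow> 'a \<Rightarrow> real"
  assumes sym: "\<And>x y. x \<in> M \<Longrightarrow> y \<in> M \<Longrightarrow> d x y = d y x"
    and tri: "\<And>x y z. x \<in> M \<Longrightarrow> y \<in> M \<Longrightarrow> z \<in> M \<Longrightarrow> d x z \<le> d x y + d y z"
    and X: "X \<subseteq> M" and dense: "\<And>z. z \<in> M \<Longrightarrow> \<exists>x\<in>X. d z x \<le> 1"
    and c: "c > 0" and N: "N > 0"
    and growth: "\<And>\<rho>. \<rho> > 0 \<Longrightarrow> \<exists>z\<in>M. finite {y\<in>X. d z y \<le> \<rho>} \<and>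
      real (card {y\<in>X. d z y \<le> \<rho>}) \<le> (c * (\<rho> + 1)) ^ N"
    and R: "R > 0" and e: "e > 0"
  shows "\<exists>F B. finite F \<and> F \<noteq> {} \<and> F \<subseteq> X \<and> finite B \<and> F \<subseteq> B \<and>
      real (card B) \<le> (1 + e) * real (card F) \<and> (\<forall>x\<in>X. \<forall>y\<in>F. d x y \<le> R \<longrightarrow> x \<in> B)"
proof -
  \<comment> \<open>Radius at least 1 guarantees a net point in the ball \<open>B 1\<close>, since
    the net is 1-dense. The count starts at index \<open>Suc 0\<close> because \<open>B 0\<close>
    may be empty.\<close>
  define R' where "R' = max R 1"
  have R': "R \<le> R'" "1 \<le> R'" by (auto simp: R'_def)
  obtain k where k: "c * (R' + 1) * (real k * real N + 1) < (1 + e) ^ k"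
    using exponential_dominates_linear[OF e] .
  define m where "m = k * N"
  obtain z where z: "z \<in> M" and fin: "finite {y\<in>X. d z y \<le> (real m + 1) * R'}"
    and crd: "real (card {y\<in>X. d z y \<le> (real m + 1) * R'}) \<le> (c * ((real m + 1) * R' + 1)) ^ N"
    using growth[of "(real m + 1) * R'"] R' by (auto simp: mult_pos_pos)
  define B where "B j = {y\<in>X. d z y \<le> real j * R'}" for j
  have finB: "finite (B j)" if "j \<le> Suc m" for j
  proof (rule finite_subset[OF _ fin])
    have "real j * R' \<le> (real m + 1) * R'" using that R' by (intro mult_right_mono) auto
    then show "B j \<subseteq> {y\<in>X. d z y \<le> (real m + 1) * R'}" by (auto simp: B_def)
  qed
  have Bmono: "B i \<subseteq> B j" if "i \<le> j" for i j
  proof -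
    have "real i * R' \<le> real j * R'" using that R' by (intro mult_right_mono) auto
    then show ?thesis by (auto simp: B_def)
  qed
  obtain x where x: "x \<in> X" "d z x \<le> 1" using dense[OF z] by blast
  have Bne: "B (Suc j) \<noteq> {}" for j
  proof -
    have "x \<in> B 1" using x R' by (simp add: B_def)
    then show ?thesis using Bmono[of 1 "Suc j"] by auto
  qed
  have "\<exists>j<m. real (card (B (Suc (Suc j)))) \<le> (1 + e) * real (card (B (Suc j)))"
  proof (rule ccontr)
    assume "\<not> ?thesis"
    then have *: "(1 + e) * real (card (B (Suc j))) < real (card (B (Suc (Suc j))))" if "j < m" for j
      using that by force
    have "(1 + e) ^ j \<le> real (card (B (Suc j)))" if "j \<le> m" for j
      using that
    proof (induction j)
      case 0
      have "card (B (Suc 0)) > 0" using Bne[of 0] finB[of "Suc 0"] by (simp add: card_gt_0_iff)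
      then show ?case by simp
    next
      case (Suc j)
      then have "(1 + e) * (1 + e) ^ j \<le> (1 + e) * real (card (B (Suc j)))"
        using e by (intro mult_left_mono) auto
      then show ?case using *[of j] Suc by simp
    qed
    then have "(1 + e) ^ m \<le> real (card (B (Suc m)))" by simp
    also have "\<dots> \<le> (c * ((real m + 1) * R' + 1)) ^ N"
      using crd by (simp add: B_def add.commute)
    also have "\<dots> \<le> (c * (R' + 1) * (real k * real N + 1)) ^ N"
    proof (rule power_mono)
      have "(real m + 1) * R' + 1 \<le> (R' + 1) * (real m + 1)" by (simp add: algebra_simps)
      then show "c * ((real m + 1) * R' + 1) \<le> c * (R' + 1) * (real k * real N + 1)"
        using c by (simp add: m_def mult.assoc)
    qed (use c R' in auto)
    also have "\<dots> < ((1 + e) ^ k) ^ N" using k N c R' by (intro power_strict_mono) auto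
    finally show False by (simp add: m_def power_mult)
  qed
  then obtain j where j: "j < m" "real (card (B (Suc (Suc j)))) \<le> (1 + e) * real (card (B (Suc j)))"
    by blast
  have "u \<in> B (Suc (Suc j))" if "u \<in> X" "y \<in> B (Suc j)" "d u y \<le> R" for u y
  proof -
    have y: "y \<in> X" "d z y \<le> real (Suc j) * R'" using that by (auto simp: B_def)
    have "d z u \<le> d z y + d y u" using tri[of z y u] z y that X by blast
    also have "d y u = d u y" using sym[of y u] y that X by blast
    also have "d z y + d u y \<le> real (Suc j) * R' + R'" using y that R' by linarith
    finally show ?thesis using that by (simp add: B_def algebra_simps)
  qed
  then show ?thesis
    using finB[of "Suc j"] finB[of "Suc (Suc j)"] j Bne[of j] Bmono[of "Suc j" "Suc (Suc j)"]
    by (intro exI[of _ "B (Suc j)"] exI[of _ "B (Suc (Suc j))"]) (auto simp: B_def)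
qed

section \<open>Projective images close to a polytope\<close>

lemma proj_map_proj_pt:
  assumes "linear B" "v \<noteq> 0"
  shows "proj_map B (proj_pt v) = proj_pt (B v)"
  using span_linear_image[OF assms(1), of "{v}"] assms(2)
  by (simp add: proj_map_def Rep_proj_pt) (simp add: proj_pt_def)

lemma infdist_lessE:
  assumes "infdist x S < e" "S \<noteq> {}"
  obtains y where "y \<in> S" "dist x y < e"
  using assms by (auto simp: infdist_notempty cINF_less_iff)

text \<open>The compact image of \<open>K\<close> has positive distance to the complement of the
  open image of \<open>U\<close>; that distance is \<open>e\<close>. In particular, sets close to
  the polygon cannot leave its affine chart.\<close>

lemma Hausdorff_outer:
  fixes A :: "(real^'n::finite) \<times> real \<Rightarrow> (real^'n) \<times> real"
  assumes A: "linear A" "bij A" and K: "compact K" "K \<noteq> {}" "open U" "K \<subseteq> U"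
  obtains e where "e > 0"
    "\<And>E. hausdorff_dist (affine_chart A ` K) (closure E) < e \<Longrightarrow> E \<subseteq> affine_chart A ` U"
\<comment> \<open>For an empty complement \<open>infdist\<close> has the default value 0 and would
  give no positive \<open>e\<close>.\<close>
proof (cases "affine_chart A ` U = UNIV")
  case True
  then show thesis using that[of 1] by simp
next
  case False
  define W where "W = - affine_chart A ` U"
  have W: "closed W" "W \<noteq> {}" using open_affine_chart[OF A K(3)] False by (auto simp: W_def)
  have "compact (affine_chart A ` K)"
    using continuous_on_subset[OF continuous_affine_chart[OF A]] K(1)
    by (intro compact_continuous_image) auto
  moreover have "continuous_on (affine_chart A ` K) (\<lambda>x. infdist x W)" by (intro continuous_intros)
  ultimately obtain x0 where x0: "x0 \<in> affine_chart A ` K"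
    "\<And>x. x \<in> affine_chart A ` K \<Longrightarrow> infdist x0 W \<le> infdist x W"
    using continuous_attains_inf[of "affine_chart A ` K" "\<lambda>x. infdist x W"] K(2) by blast
  have "x0 \<notin> W" using x0(1) K(4) by (auto simp: W_def)
  then have "infdist x0 W > 0"
    using W in_closed_iff_infdist_zero[of W x0] infdist_nonneg[of x0 W] by linarith
  moreover have "E \<subseteq> affine_chart A ` U"
    if E: "hausdorff_dist (affine_chart A ` K) (closure E) < infdist x0 W" for E
  proof
    fix x assume "x \<in> E"
    then have "infdist x (affine_chart A ` K) < infdist x0 W"
      using hausdorff_dist_lessD(2)[OF E] closure_subset by blast
    then obtain y where y: "y \<in> affine_chart A ` K" "dist x y < infdist x0 W"
      using K(2) by (auto elim: infdist_lessE)
    show "x \<in> affine_chart A ` U"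
    proof (rule ccontr)
      assume "x \<notin> affine_chart A ` U"
      then have "infdist y W \<le> dist y x" by (intro infdist_le) (simp add: W_def)
      then show False using y x0(2)[OF y(1)] by (simp add: dist_commute)
    qed
  qed
  ultimately show thesis by (rule that)
qed

text \<open>The chart is no isometry, but its inverse is uniformly continuous on the compact image
  of \<open>V\<close>, so chordal closeness becomes Euclidean closeness.\<close>

lemma Hausdorff_inner:
  fixes A :: "(real^'n::finite) \<times> real \<Rightarrow> (real^'n) \<times> real"
  assumes A: "linear A" "bij A" and K: "K \<subseteq> V" "compact V" and \<eta>: "\<eta> > 0"
  obtains e where "e > 0"
    "\<And>D y. hausdorff_dist (affine_chart A ` K) (closure (affine_chart A ` D)) < e \<Longrightarrow>
       D \<noteq> {} \<Longrightarrow> D \<subseteq> V \<Longrightarrow> y \<in> K \<Longrightarrow> \<exists>z\<in>D. norm (y - z) < \<eta>"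
proof -
  have cont: "continuous_on V (affine_chart A)"
    using continuous_on_subset[OF continuous_affine_chart[OF A]] by auto
  have inj: "inj_on (affine_chart A) V"
    using inj_affine_chart[OF A] by (rule inj_on_subset) simp
  obtain g where g: "homeomorphism V (affine_chart A ` V) (affine_chart A) g"
    using homeomorphism_compact[OF K(2) cont refl inj] by blast
  have "uniformly_continuous_on (affine_chart A ` V) g"
    using g compact_continuous_image[OF cont K(2)]
    by (intro compact_uniformly_continuous) (auto simp: homeomorphism_def)
  then obtain e where e: "e > 0" "\<And>P Q. P \<in> affine_chart A ` V \<Longrightarrow> Q \<in> affine_chart A ` V \<Longrightarrow>
      dist Q P < e \<Longrightarrow> dist (g Q) (g P) < \<eta>"
    using \<eta> unfolding uniformly_continuous_on_def by meson
  have "\<exists>z\<in>D. norm (y - z) < \<eta>"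
    if D: "hausdorff_dist (affine_chart A ` K) (closure (affine_chart A ` D)) < e"
      "D \<noteq> {}" "D \<subseteq> V" "y \<in> K" for D y
  proof -
    have "infdist (affine_chart A y) (closure (affine_chart A ` D)) < e"
      using hausdorff_dist_lessD(1)[OF D(1)] D(4) by blast
    then obtain P where P: "P \<in> closure (affine_chart A ` D)" "dist (affine_chart A y) P < e"
      by (rule infdist_lessE) (use D(2) in simp)
    have "e - dist (affine_chart A y) P > 0" using P by simp
    then obtain z where z: "z \<in> D" "dist (affine_chart A z) P < e - dist (affine_chart A y) P"
      using P(1) unfolding closure_approachable by blast
    have "dist (affine_chart A y) (affine_chart A z) < e"
      using dist_triangle2[of "affine_chart A y" "affine_chart A z" P] z by linarith
    moreover have "y \<in> V" "z \<in> V" using D z K by auto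
    ultimately have "dist (g (affine_chart A y)) (g (affine_chart A z)) < \<eta>" by (intro e) auto
    then have "norm (y - z) < \<eta>"
      using homeomorphism_apply1[OF g] \<open>y \<in> V\<close> \<open>z \<in> V\<close> by (simp add: dist_norm)
    then show ?thesis using z by blast
  qed
  then show thesis using e(1) by (intro that)
qed

lemma convex_projective_image:
  fixes D :: "'a::real_vector set" and S :: "'a \<times> real \<Rightarrow> 'b::real_vector \<times> real"
  assumes S: "linear S" and D: "convex D" and pos: "\<And>x. x \<in> D \<Longrightarrow> snd (S (x, 1)) > 0"
  shows "convex ((\<lambda>x. fst (S (x, 1)) /\<^sub>R snd (S (x, 1))) ` D)" (is "convex (?Y ` D)")
proof (rule convexI)
  fix y1 y2 u v assume "y1 \<in> ?Y ` D" "y2 \<in> ?Y ` D" and uv: "0 \<le> u" "0 \<le> v" "u + v = (1::real)"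
  then obtain x1 x2 where x: "x1 \<in> D" "x2 \<in> D" "y1 = ?Y x1" "y2 = ?Y x2" by blast
  \<comment> \<open>Dividing the weights by the heights makes
    \<open>\<alpha> *\<^sub>R S (x1, 1) + \<beta> *\<^sub>R S (x2, 1)\<close> a vector of height
    \<open>u + v = 1\<close> above the wanted point; \<open>x3\<close> is its normalised
    source.\<close>
  define \<alpha> where "\<alpha> = u / snd (S (x1, 1))"
  define \<beta> where "\<beta> = v / snd (S (x2, 1))"
  have nn: "\<alpha> \<ge> 0" "\<beta> \<ge> 0" using uv pos[OF x(1)] pos[OF x(2)] by (auto simp: \<alpha>_def \<beta>_def)
  have u: "u = \<alpha> * snd (S (x1, 1))" and v: "v = \<beta> * snd (S (x2, 1))"
    using pos[OF x(1)] pos[OF x(2)] by (auto simp: \<alpha>_def \<beta>_def)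
  have "\<alpha> + \<beta> \<noteq> 0" using nn u v uv by (auto simp: add_nonneg_eq_0_iff)
  then have ab: "\<alpha> + \<beta> > 0" using nn by linarith
  define x3 where "x3 = (\<alpha> / (\<alpha> + \<beta>)) *\<^sub>R x1 + (\<beta> / (\<alpha> + \<beta>)) *\<^sub>R x2"
  have "x3 \<in> D" unfolding x3_def using x nn ab
    by (intro convexD[OF D]) (auto simp: add_divide_distrib[symmetric])
  have "(x3, 1::real) = (1 / (\<alpha> + \<beta>)) *\<^sub>R (\<alpha> *\<^sub>R (x1, 1) + \<beta> *\<^sub>R (x2, 1))"
    using ab by (simp add: x3_def scaleR_right_distrib)
  then have S3: "S (x3, 1) = (1 / (\<alpha> + \<beta>)) *\<^sub>R (\<alpha> *\<^sub>R S (x1, 1) + \<beta> *\<^sub>R S (x2, 1))"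
    by (simp only: linear_add[OF S] linear_cmul[OF S])
  have "snd (S (x3, 1)) = 1 / (\<alpha> + \<beta>)" using uv u v by (simp add: S3)
  moreover have "fst (S (x3, 1)) = (1 / (\<alpha> + \<beta>)) *\<^sub>R (u *\<^sub>R y1 + v *\<^sub>R y2)"
  proof -
    have "u *\<^sub>R y1 = \<alpha> *\<^sub>R fst (S (x1, 1))" "v *\<^sub>R y2 = \<beta> *\<^sub>R fst (S (x2, 1))"
      by (simp_all add: x(3,4) \<alpha>_def \<beta>_def divide_inverse)
    then show ?thesis by (simp add: S3)
  qed
  ultimately have "?Y x3 = u *\<^sub>R y1 + v *\<^sub>R y2" using ab by simp
  then show "u *\<^sub>R y1 + v *\<^sub>R y2 \<in> ?Y ` D" by (intro rev_image_eqI[OF \<open>x3 \<in> D\<close>]) simp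
qed

text \<open>An affine function with both signs on a convex set vanishes on a segment. The factor
  \<sigma> serves to choose the sign of a lift so that all heights on \<open>D\<close> are
  positive.\<close>

lemma linear_height_one_constant_sign:
  fixes h :: "'a::real_vector \<times> real \<Rightarrow> real"
  assumes h: "linear h" and D: "convex D" and nz: "\<And>x. x \<in> D \<Longrightarrow> h (x, 1) \<noteq> 0"
  obtains \<sigma> :: real where "\<sigma> \<noteq> 0" "\<And>x. x \<in> D \<Longrightarrow> \<sigma> * h (x, 1) > 0"
proof -
  have *: False if xy: "x \<in> D" "y \<in> D" "h (x, 1) > 0" "h (y, 1) < 0" for x y
  proof -
    define s where "s = h (x, 1) / (h (x, 1) - h (y, 1))"
    have s: "0 \<le> s" "s \<le> 1" using xy by (auto simp: s_def divide_le_eq_1)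
    have "h ((1 - s) *\<^sub>R x + s *\<^sub>R y, 1) = (1 - s) * h (x, 1) + s * h (y, 1)"
      by (rule linear_height_one_segment[OF h])
    also have "\<dots> = h (x, 1) - s * (h (x, 1) - h (y, 1))" by (simp add: algebra_simps)
    also have "\<dots> = 0" using xy by (simp add: s_def)
    finally show False using nz[of "(1 - s) *\<^sub>R x + s *\<^sub>R y"] D xy s by (auto simp: convex_alt)
  qed
  show thesis
  proof (cases "\<exists>x\<in>D. h (x, 1) > 0")
    case True
    then have "h (y, 1) > 0" if "y \<in> D" for y using * nz[OF that] that by (meson linorder_neqE_linordered_idom)
    then show thesis using that[of 1] by simp
  next
    case False
    then have "h (y, 1) < 0" if "y \<in> D" for y using nz[OF that] that by (meson linorder_neqE_linordered_idom)
    then show thesis using that[of "-1"] by simp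
  qed
qed

section \<open>Squeezing a projective image between two polytopes\<close>

lemma polytope_halfspaces:
  fixes K :: "'a::euclidean_space set"
  assumes "polytope K"
  obtains I :: "('a \<times> real) set" where "finite I" "\<forall>i\<in>I. fst i \<noteq> 0"
    "K = {y. \<forall>i\<in>I. fst i \<bullet> y \<le> snd i}"
proof -
  obtain F where F: "finite F" "K = \<Inter>F" "\<forall>h\<in>F. \<exists>a b. a \<noteq> 0 \<and> h = {x. a \<bullet> x \<le> b}"
    using polytope_imp_polyhedron[OF assms] unfolding polyhedron_def by blast
  then obtain a b where ab: "\<And>h. h \<in> F \<Longrightarrow> a h \<noteq> 0" "\<And>h. h \<in> F \<Longrightarrow> h = {x. a h \<bullet> x \<le> b h}"
    by metis
  have "y \<in> K \<longleftrightarrow> (\<forall>h\<in>F. a h \<bullet> y \<le> b h)" for y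
    using F(2) ab(2) by blast
  then show thesis using F ab(1) by (intro that[of "(\<lambda>h. (a h, b h)) ` F"]) auto
qed


text \<open>The projective map induced by \<open>S\<close> carries \<open>D\<close> into the ball of radius \<open>R\<close>, between the
  polytopes cut out by the half-spaces \<open>I\<close> after moving each facet by \<open>\<delta>\<close> inwards and outwards.\<close>

definition polygon_approximation ::
    "('a::euclidean_space \<times> real) set \<Rightarrow> real \<Rightarrow> real \<Rightarrow> 'a set \<Rightarrow> ('a \<times> real \<Rightarrow> 'a \<times> real) \<Rightarrow> bool" where
  "polygon_approximation I R \<delta> D S \<longleftrightarrow> linear S \<and> inj S \<and>
     (\<forall>x\<in>D. snd (S (x, 1)) > 0 \<and> norm (fst (S (x, 1))) \<le> R * snd (S (x, 1)) \<and>
       (\<forall>i\<in>I. fst i \<bullet> fst (S (x, 1)) < (snd i + \<delta>) * snd (S (x, 1)))) \<and>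
     (\<forall>y. (\<forall>i\<in>I. fst i \<bullet> y < snd i - \<delta>) \<longrightarrow> (\<exists>x\<in>D. S (x, 1) = snd (S (x, 1)) *\<^sub>R (y, 1)))"

text \<open>\<open>I\<close>, \<open>z\<close> and \<open>R\<close> belong to the limit polygon and
  are fixed before \<delta>; only \<open>S\<close> varies with \<delta>. The later bounds owe their
  uniformity to this order.\<close>

lemma polygonal_normal_form:
  fixes D :: "(real^'n::finite) set"
  assumes A0: "linear A0" "bij A0" and D: "convex D" "D \<noteq> {}"
    and G: "G_polygonal (affine_chart A0 ` D)"
  obtains I :: "((real^'n) \<times> real) set" and z :: "real^'n" and R :: real
  where "finite I" "\<forall>i\<in>I. fst i \<bullet> z < snd i"
    "\<forall>\<delta>>0. \<exists>S. polygon_approximation I R \<delta> D S"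
proof -
  interpret H: Metric_space "{C :: 'n rpn set. properly_open_convex C}"
    "\<lambda>C D. hausdorff_dist (closure C) (closure D)"
    by (rule Metric_space_hausdorff)
  obtain P where P: "polygon P" and near: "\<And>e. e > 0 \<Longrightarrow>
      \<exists>g\<in>projective_group. hausdorff_dist (closure P) (closure (g ` affine_chart A0 ` D)) < e"
    using G unfolding G_polygonal_def hausdorff_topology_def H.metric_closure_of H.in_mball by blast
  obtain A K where A: "linear A" "bij A" and K: "polytope K" and PK: "P = affine_chart A ` interior K"
    and Pne: "P \<noteq> {}"
    using P unfolding polygon_def properly_open_convex_def by blast
  have intK: "interior K \<noteq> {}" using PK Pne by blast
  obtain z where z: "z \<in> interior K" using intK by blast
  have cK: "compact K" "convex K" using K by (auto simp: polytope_imp_compact polytope_imp_convex)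
  have "bounded (interior K)" using cK by (meson bounded_subset compact_imp_bounded interior_subset)
  then have clP: "closure P = affine_chart A ` K"
    unfolding PK closure_affine_chart[OF A \<open>bounded (interior K)\<close>]
    using cK intK by (simp add: convex_closure_interior closure_closed compact_imp_closed)
  obtain I :: "((real^'n) \<times> real) set" where I: "finite I" "\<forall>i\<in>I. fst i \<noteq> 0"
    "K = {y. \<forall>i\<in>I. fst i \<bullet> y \<le> snd i}" using polytope_halfspaces[OF K] .
  have zI: "fst i \<bullet> z < snd i" if i: "i \<in> I" for i
  proof -
    have "K \<subseteq> {y. fst i \<bullet> y \<le> snd i}" using I(3) i by blast
    then have "z \<in> interior {y. fst i \<bullet> y \<le> snd i}" using z interior_mono by blast
    then show ?thesis using I(2) i by (simp add: interior_halfspace_le)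
  qed
  obtain R where R: "\<And>y. y \<in> K \<Longrightarrow> norm y < R"
    using cK(1) by (meson bounded_pos_less compact_imp_bounded)
  show thesis
  proof (rule that[of I z R], use I(1) in simp, use zI in blast, intro allI impI)
    fix \<delta> :: real assume \<delta>: "\<delta> > 0"
    define U where "U = {y. norm y < R} \<inter> (\<Inter>i\<in>I. {y. fst i \<bullet> y < snd i + \<delta>})"
    have "open U" unfolding U_def using I(1)
      by (intro open_Int open_INT ballI open_Collect_less continuous_intros) auto
    moreover have "K \<subseteq> U" using R \<delta> I(3) unfolding U_def by fastforce
    moreover have "K \<noteq> {}" using intK interior_subset by fastforce
    ultimately obtain e1 where e1: "e1 > 0" "\<And>E. hausdorff_dist (affine_chart A ` K) (closure E) < e1 \<Longrightarrow>
        E \<subseteq> affine_chart A ` U"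
      using Hausdorff_outer[OF A cK(1)] by metis
    have UR: "U \<subseteq> cball 0 R" by (auto simp: U_def)
    have KR: "K \<subseteq> cball 0 R" using R by (auto simp: less_imp_le)
    \<comment> \<open>Moving a point by \<eta> changes each \<open>fst i \<bullet> y\<close> by at
      most \<delta>; the summand 1 keeps the denominator positive.\<close>
    define \<eta> where "\<eta> = \<delta> / (1 + (\<Sum>i\<in>I. norm (fst i)))"
    have s0: "1 + (\<Sum>i\<in>I. norm (fst i)) > 0" by (smt (verit) norm_ge_zero sum_nonneg)
    have \<eta>: "\<eta> > 0" using \<delta> s0 by (simp add: \<eta>_def)
    have \<eta>I: "norm (fst i) * \<eta> \<le> \<delta>" if "i \<in> I" for i
    proof -
      have "norm (fst i) \<le> 1 + (\<Sum>i\<in>I. norm (fst i))"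
        using member_le_sum[of i I "\<lambda>i. norm (fst i)"] that I(1) by simp
      then have "norm (fst i) * \<eta> \<le> (1 + (\<Sum>i\<in>I. norm (fst i))) * \<eta>"
        using \<eta> by (intro mult_right_mono) auto
      then show ?thesis using s0 by (simp add: \<eta>_def)
    qed
    obtain e2 where e2: "e2 > 0" "\<And>D y. hausdorff_dist (affine_chart A ` K) (closure (affine_chart A ` D)) < e2 \<Longrightarrow>
       D \<noteq> {} \<Longrightarrow> D \<subseteq> cball 0 R \<Longrightarrow> y \<in> K \<Longrightarrow> \<exists>z\<in>D. norm (y - z) < \<eta>"
      using Hausdorff_inner[OF A KR compact_cball \<eta>] by metis
    obtain g where g: "g \<in> projective_group"
      "hausdorff_dist (affine_chart A ` K) (closure (g ` affine_chart A0 ` D)) < min e1 e2"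
      using near[of "min e1 e2"] e1(1) e2(1) clP by auto
    obtain B where B: "linear B" "bij B" "g = proj_map B" using g(1) by (auto simp: projective_group_def)
    define T where "T = B \<circ> A0"
    have T: "linear T" "bij T" using A0 B by (auto simp: T_def linear_compose bij_comp)
    have gE: "g ` affine_chart A0 ` D = affine_chart T ` D"
      unfolding image_image by (rule image_cong[OF refl])
        (simp add: B(3) affine_chart_def proj_map_proj_pt[OF B(1) chart_vec_nonzero[OF A0]] T_def)
    \<comment> \<open>This lifts the passage from the chart of \<open>C\<close>, through the
      projective transformation, to the chart of the polygon.\<close>
    define S0 where "S0 = inv A \<circ> T"
    have S0: "linear S0" "bij S0"
      using A T by (auto simp: S0_def linear_compose bij_comp bij_imp_bij_inv inj_linear_imp_inv_linear bij_is_inj)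
    have chT: "affine_chart T x = affine_chart A y \<longleftrightarrow>
        snd (S0 (x, 1)) \<noteq> 0 \<and> y = fst (S0 (x, 1)) /\<^sub>R snd (S0 (x, 1))" for x y
      using affine_chart_eq_iff[OF A chart_vec_nonzero[OF T, of x], of y]
      by (simp add: affine_chart_def[of T] S0_def)
    have "affine_chart T ` D \<subseteq> affine_chart A ` U" using e1(2) g(2) gE by simp
    then have S0U: "snd (S0 (x, 1)) \<noteq> 0" "fst (S0 (x, 1)) /\<^sub>R snd (S0 (x, 1)) \<in> U" if "x \<in> D" for x
      using that chT by (metis (no_types, lifting) image_iff subsetD)+
    have "linear (\<lambda>v. snd (S0 v))" using linear_compose[OF S0(1) linear_snd] by (simp add: o_def)
    then obtain \<sigma> where \<sigma>: "\<sigma> \<noteq> 0" "\<And>x. x \<in> D \<Longrightarrow> \<sigma> * snd (S0 (x, 1)) > 0"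
      using linear_height_one_constant_sign[of "\<lambda>v. snd (S0 v)" D] D(1) S0U(1) by blast
    define S where "S = (\<lambda>v. \<sigma> *\<^sub>R S0 v)"
    have S: "linear S" "inj S"
      using S0 \<sigma>(1) linear_compose_scale_right[OF S0(1), of \<sigma>]
      by (simp_all add: S_def inj_def bij_def)
    define Y where "Y x = fst (S (x, 1)) /\<^sub>R snd (S (x, 1))" for x
    have h: "snd (S (x, 1)) > 0" if "x \<in> D" for x using \<sigma>(2)[OF that] by (simp add: S_def)
    have YS0: "Y x = fst (S0 (x, 1)) /\<^sub>R snd (S0 (x, 1))" for x
      using \<sigma>(1) by (simp add: Y_def S_def)
    have YU: "Y x \<in> U" if "x \<in> D" for x using S0U(2)[OF that] by (simp add: YS0)
    have SY: "S (x, 1) = snd (S (x, 1)) *\<^sub>R (Y x, 1)" if "x \<in> D" for x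
      using h[OF that] by (simp add: Y_def prod_eq_iff)
    have "affine_chart T ` D = affine_chart A ` Y ` D"
      unfolding image_image using chT S0U(1) YS0 by (intro image_cong) auto
    then have close: "hausdorff_dist (affine_chart A ` K) (closure (affine_chart A ` Y ` D)) < e2"
      using g(2) gE by simp
    have cY: "convex (Y ` D)" unfolding Y_def using S(1) D(1) h by (rule convex_projective_image)
    \<comment> \<open>Closeness alone gives nearby points; convexity fills the gaps. If
      \<open>y\<close> were missed, a hyperplane would separate it from \<open>Y\<close>
      D\<open>. Pushing\<close>y\<open>by \<eta> along the outward normal stays in\<close>K\<open>, yet ends at distance at least \<eta> from\<close>Y
      \<open>D\<close>.\<close>
    have inner: "y \<in> Y ` D" if y: "\<forall>i\<in>I. fst i \<bullet> y < snd i - \<delta>" for y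
    proof (rule ccontr)
      assume "y \<notin> Y ` D"
      then obtain u c where u: "u \<noteq> 0" "u \<bullet> y \<ge> c" "\<And>w. w \<in> Y ` D \<Longrightarrow> u \<bullet> w \<le> c"
        using separating_hyperplane_sets[OF cY convex_singleton[of y]] D(2) by auto
      define y' where "y' = y + (\<eta> / norm u) *\<^sub>R u"
      have "fst i \<bullet> y' \<le> snd i" if i: "i \<in> I" for i
      proof -
        have "fst i \<bullet> ((\<eta> / norm u) *\<^sub>R u) \<le> norm (fst i) * norm ((\<eta> / norm u) *\<^sub>R u)"
          by (rule norm_cauchy_schwarz)
        also have "\<dots> = norm (fst i) * \<eta>" using u(1) \<eta> by simp
        also have "\<dots> \<le> \<delta>" by (rule \<eta>I[OF i])
        finally show ?thesis using y i by (auto simp: y'_def inner_add_right)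
      qed
      then have "y' \<in> K" using I(3) by blast
      moreover have "Y ` D \<subseteq> cball 0 R" using YU UR by blast
      ultimately obtain w where w: "w \<in> Y ` D" "norm (y' - w) < \<eta>"
        using e2(2)[OF close, of y'] D(2) by blast
      have "\<eta> * norm u = u \<bullet> (y' - y)" using u(1) by (simp add: y'_def dot_square_norm power2_eq_square)
      also have "\<dots> \<le> u \<bullet> (y' - w)" using u(2) u(3)[OF w(1)] by (simp add: inner_diff_right)
      also have "\<dots> \<le> norm u * norm (y' - w)" by (rule norm_cauchy_schwarz)
      also have "\<dots> < norm u * \<eta>" using w(2) u(1) by simp
      finally show False by (simp add: mult.commute)
    qed
    have outer: "norm (fst (S (x, 1))) \<le> R * snd (S (x, 1))"
      "i \<in> I \<Longrightarrow> fst i \<bullet> fst (S (x, 1)) < (snd i + \<delta>) * snd (S (x, 1))" if x: "x \<in> D" for x i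
    proof -
      have f: "fst (S (x, 1)) = snd (S (x, 1)) *\<^sub>R Y x" using h[OF x] by (simp add: Y_def)
      show "norm (fst (S (x, 1))) \<le> R * snd (S (x, 1))"
        unfolding f using h[OF x] YU[OF x] by (simp add: U_def mult.commute)
      show "fst i \<bullet> fst (S (x, 1)) < (snd i + \<delta>) * snd (S (x, 1))" if "i \<in> I"
        unfolding f using h[OF x] YU[OF x] that by (simp add: U_def mult.commute)
    qed
    show "\<exists>S. polygon_approximation I R \<delta> D S"
      unfolding polygon_approximation_def
    proof (intro exI[of _ S] conjI ballI allI impI)
      fix y assume "\<forall>i\<in>I. fst i \<bullet> y < snd i - \<delta>"
      then obtain x where "x \<in> D" "y = Y x" using inner by blast
      then show "\<exists>x\<in>D. S (x, 1) = snd (S (x, 1)) *\<^sub>R (y, 1)" using SY by blast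
    qed (use S h outer in auto)
  qed
qed

section \<open>Polynomial growth\<close>

text \<open>The closure of the image of \<open>D\<close> stays in the affine chart, so a frontier point of \<open>D\<close> has an
  image, which lies outside the inner polytope.\<close>

lemma polygon_approximation_frontier:
  fixes D :: "'a::euclidean_space set"
  assumes D: "open D" and S: "polygon_approximation I R \<delta> D S" and a: "a \<in> frontier D"
  shows "\<exists>i\<in>I. (snd i - \<delta>) * snd (S (a, 1)) \<le> fst i \<bullet> fst (S (a, 1))"
proof (rule ccontr)
  assume "\<not> ?thesis"
  then have neg: "fst i \<bullet> fst (S (a, 1)) < (snd i - \<delta>) * snd (S (a, 1))" if "i \<in> I" for i
    using that by force
  have lin: "linear S" and inj: "inj S"
    and out: "\<And>x. x \<in> D \<Longrightarrow> snd (S (x, 1)) > 0 \<and> norm (fst (S (x, 1))) \<le> R * snd (S (x, 1))"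
    and inn: "\<And>y. (\<forall>i\<in>I. fst i \<bullet> y < snd i - \<delta>) \<Longrightarrow> \<exists>x\<in>D. S (x, 1) = snd (S (x, 1)) *\<^sub>R (y, 1)"
    using S unfolding polygon_approximation_def by blast+
  have acl: "a \<in> closure D" and anD: "a \<notin> D" using a D by (auto simp: frontier_def interior_open)
  have cont: "continuous_on (closure D) (\<lambda>x. S (x, 1))"
    using linear_continuous_on_compose[OF _ lin, of "closure D" "\<lambda>x. (x, 1)"]
    by (simp add: continuous_on_Pair)
  \<comment> \<open>In the limit, height 0 would force \<open>fst (S (a, 1)) = 0\<close>, against
    injectivity of \<open>S\<close>; so the frontier point does not go to infinity.\<close>
  have "R * snd (S (a, 1)) - norm (fst (S (a, 1))) \<ge> 0"
    by (rule continuous_ge_on_closure[of D "\<lambda>x. R * snd (S (x, 1)) - norm (fst (S (x, 1)))", OF _ acl])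
       (use out cont in \<open>auto intro!: continuous_intros\<close>)
  moreover have "snd (S (a, 1)) \<ge> 0"
    by (rule continuous_ge_on_closure[of D "\<lambda>x. snd (S (x, 1))", OF _ acl])
       (use out cont in \<open>auto intro!: continuous_intros simp: less_imp_le\<close>)
  moreover have "S (a, 1) \<noteq> 0"
  proof
    assume "S (a, 1) = 0"
    then have "S (a, 1) = S 0" using lin by (simp add: linear_0)
    then show False using inj by (simp add: inj_eq zero_prod_def)
  qed
  then have "snd (S (a, 1)) = 0 \<Longrightarrow> fst (S (a, 1)) \<noteq> 0" by (simp add: prod_eq_iff)
  ultimately have h: "snd (S (a, 1)) > 0" by (cases "snd (S (a, 1)) = 0") auto
  define y where "y = fst (S (a, 1)) /\<^sub>R snd (S (a, 1))"
  have Sa: "S (a, 1) = snd (S (a, 1)) *\<^sub>R (y, 1)" using h by (simp add: y_def prod_eq_iff)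
  have "fst i \<bullet> y < snd i - \<delta>" if "i \<in> I" for i
    using neg[OF that] h by (simp add: y_def divide_inverse_commute[symmetric] divide_less_eq)
  then obtain x where x: "x \<in> D" "S (x, 1) = snd (S (x, 1)) *\<^sub>R (y, 1)" using inn by blast
  have "S (snd (S (a, 1)) *\<^sub>R (x, 1)) = S (snd (S (x, 1)) *\<^sub>R (a, 1))"
    unfolding linear_cmul[OF lin] by (subst x(2), subst Sa) (simp add: mult.commute)
  then have eq: "snd (S (a, 1)) *\<^sub>R (x, 1::real) = snd (S (x, 1)) *\<^sub>R (a, 1)" by (rule injD[OF inj])
  have sa: "snd (S (a, 1)) = snd (S (x, 1))" using arg_cong[OF eq, of snd] by simp
  have "snd (S (a, 1)) *\<^sub>R (x, 1::real) = snd (S (a, 1)) *\<^sub>R (a, 1)" using eq unfolding sa .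
  then have "x = a" using h by (metis Pair_inject less_irrefl scaleR_cancel_left)
  then show False using x(1) anD by simp
qed

text \<open>On a ball of radius \<open>\<rho>\<close>, the logarithms of the affine functions defining the inner polytope lie
  in an interval of length linear in \<open>\<rho>\<close>, and they control the Hilbert distance from above.\<close>

lemma polygon_approximation_packing:
  fixes D :: "'a::euclidean_space set"
  assumes D: "open D" "bounded D" "convex D" and I: "finite I"
    and S: "polygon_approximation I R \<delta> D S"
    and z: "z \<in> D" "S (z, 1) = snd (S (z, 1)) *\<^sub>R (w, 1)"
    and m: "\<And>i. i \<in> I \<Longrightarrow> m \<le> snd i - fst i \<bullet> w" "m > 0"
    and \<delta>: "\<delta> > 0" "4 * \<delta> \<le> m * exp (- 2 * \<rho>)"
    and M: "\<And>i. i \<in> I \<Longrightarrow> snd i + norm (fst i) * R \<le> M"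
    and Y: "Y \<subseteq> D" "\<And>y. y \<in> Y \<Longrightarrow> affine_hilbert_dist D z y \<le> \<rho>"
    and sep: "\<And>x y. x \<in> Y \<Longrightarrow> y \<in> Y \<Longrightarrow> x \<noteq> y \<Longrightarrow> affine_hilbert_dist D x y \<ge> 1"
  shows "finite Y \<and> card Y \<le> card {\<lfloor>ln (m / 2) - 2 * \<rho>\<rfloor>..\<lfloor>ln M\<rfloor>} ^ card I"
proof -
  have lin: "linear S"
    and h: "\<And>x. x \<in> D \<Longrightarrow> snd (S (x, 1)) > 0"
    and R: "\<And>x. x \<in> D \<Longrightarrow> norm (fst (S (x, 1))) \<le> R * snd (S (x, 1))"
    and out: "\<And>x i. x \<in> D \<Longrightarrow> i \<in> I \<Longrightarrow> fst i \<bullet> fst (S (x, 1)) < (snd i + \<delta>) * snd (S (x, 1))"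
    using S unfolding polygon_approximation_def by blast+
  \<comment> \<open>The function of facet \<open>i\<close> moved by \<open>t\<close>, pulled back by
    \<open>S\<close>. It is used for \<open>t = \<delta>\<close>, positive on \<open>D\<close>, and
    for \<open>t = - \<delta>\<close>, where positivity on \<open>Y\<close> has to be
    proved.\<close>
  define \<phi> where "\<phi> i t v = (snd i + t) * snd (S v) - fst i \<bullet> fst (S v)" for i t v
  have lin\<phi>: "linear (\<phi> i t)" for i t
    unfolding \<phi>_def using lin by (intro linearI) (auto simp: linear_add linear_cmul inner_add_right algebra_simps)
  have linh: "linear (\<lambda>v. snd (S v))" using linear_compose[OF lin linear_snd] by (simp add: o_def)
  define f where "f i x = \<phi> i (- \<delta>) (x, 1) / snd (S (x, 1))" for i x
  have lower: "f i x \<ge> m / 2 * exp (- 2 * \<rho>)" if x: "x \<in> Y" and i: "i \<in> I" for x i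
  proof -
    have xD: "x \<in> D" using x Y by blast
    have pos: "\<phi> i \<delta> (y, 1) > 0" if "y \<in> D" for y using out[OF that i] by (simp add: \<phi>_def)
    \<comment> \<open>The height and the outer facet form an admissible pair. Because of the factor
      1/2, the logarithm of their quotient drops by at most \<open>2 * \<rho>\<close> from
      \<open>z\<close> to \<open>x\<close>.\<close>
    have "1 / 2 * (ln (snd (S (x, 1)) / snd (S (z, 1))) + ln (\<phi> i \<delta> (z, 1) / \<phi> i \<delta> (x, 1)))
        \<le> affine_hilbert_dist D z x"
      by (rule affine_hilbert_dist_lower[OF D z(1) xD, of "\<lambda>v. snd (S v)" "\<phi> i \<delta>"])
         (use pos h lin\<phi> linh in \<open>auto simp: cone_dual_def\<close>)
    also have "\<dots> \<le> \<rho>" by (rule Y(2)[OF x])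
    finally have "ln (\<phi> i \<delta> (z, 1) / snd (S (z, 1))) - 2 * \<rho> \<le> ln (\<phi> i \<delta> (x, 1) / snd (S (x, 1)))"
      using pos[OF z(1)] pos[OF xD] h[OF z(1)] h[OF xD] by (simp add: ln_div)
    moreover have "\<phi> i \<delta> (z, 1) / snd (S (z, 1)) \<ge> m"
    proof -
      have "\<phi> i \<delta> (z, 1) = (snd i + \<delta> - fst i \<bullet> w) * snd (S (z, 1))"
        unfolding \<phi>_def by (subst (2) z(2)) (simp add: algebra_simps)
      then show ?thesis using m(1)[OF i] \<delta>(1) h[OF z(1)] by simp
    qed
    then have "ln m \<le> ln (\<phi> i \<delta> (z, 1) / snd (S (z, 1)))" using m(2) by simp
    ultimately have "ln m - 2 * \<rho> \<le> ln (\<phi> i \<delta> (x, 1) / snd (S (x, 1)))" by linarith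
    then have "exp (ln m - 2 * \<rho>) \<le> \<phi> i \<delta> (x, 1) / snd (S (x, 1))"
      using pos[OF xD] h[OF xD] by (metis divide_pos_pos exp_le_cancel_iff exp_ln)
    \<comment> \<open>Passing from the outer to the inner facet costs \<open>2 * \<delta>\<close>,
      at most half of the lower bound just found.\<close>
    moreover have "\<phi> i \<delta> (x, 1) / snd (S (x, 1)) = f i x + 2 * \<delta>"
      using h[OF xD] by (simp add: f_def \<phi>_def field_simps)
    ultimately show ?thesis using \<delta>(2) m(2) by (simp add: exp_diff exp_minus field_simps)
  qed
  have fpos: "f i x > 0" if "x \<in> Y" "i \<in> I" for x i
    by (rule less_le_trans[OF _ lower[OF that]]) (use m(2) in simp)
  have upper: "f i x \<le> M" if x: "x \<in> Y" and i: "i \<in> I" for x i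
  proof -
    have xD: "x \<in> D" using x Y by blast
    have "- (fst i \<bullet> fst (S (x, 1))) \<le> norm (fst i) * norm (fst (S (x, 1)))"
      using Cauchy_Schwarz_ineq2[of "fst i" "fst (S (x, 1))"] by linarith
    also have "\<dots> \<le> norm (fst i) * (R * snd (S (x, 1)))"
      by (rule mult_left_mono[OF R[OF xD]]) simp
    finally have "\<phi> i (- \<delta>) (x, 1) \<le> (snd i - \<delta> + norm (fst i) * R) * snd (S (x, 1))"
      by (simp add: \<phi>_def algebra_simps)
    then have "f i x \<le> snd i - \<delta> + norm (fst i) * R"
      using h[OF xD] by (simp add: f_def divide_le_eq)
    then show ?thesis using M[OF i] \<delta>(1) by linarith
  qed
  define J where "J = {\<lfloor>ln (m / 2) - 2 * \<rho>\<rfloor>..\<lfloor>ln M\<rfloor>}"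
  \<comment> \<open>Rounding the logarithms puts the points into unit boxes; two points in one box
    would be at distance below 1.\<close>
  define code where "code x = (\<lambda>i\<in>I. \<lfloor>ln (f i x)\<rfloor>)" for x
  have "code ` Y \<subseteq> PiE I (\<lambda>_. J)"
  proof (intro image_subsetI PiE_I)
    fix x i assume x: "x \<in> Y" and i: "i \<in> I"
    have "ln (m / 2 * exp (- 2 * \<rho>)) \<le> ln (f i x)" using lower[OF x i] fpos[OF x i] m(2) by simp
    moreover have "ln (m / 2 * exp (- 2 * \<rho>)) = ln (m / 2) - 2 * \<rho>"
      using m(2) by (subst ln_mult) simp_all
    ultimately have "ln (m / 2) - 2 * \<rho> \<le> ln (f i x)" by linarith
    moreover have "ln (f i x) \<le> ln M" using upper[OF x i] fpos[OF x i] by simp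
    ultimately show "code x i \<in> J" using i by (simp add: code_def J_def floor_mono)
  qed (simp add: code_def)
  moreover have "inj_on code Y"
  proof (rule inj_onI, rule ccontr)
    fix x y assume xy: "x \<in> Y" "y \<in> Y" "code x = code y" "x \<noteq> y"
    have close: "\<bar>ln (f i x) - ln (f i y)\<bar> < 1" if "i \<in> I" for i
    proof -
      have "\<lfloor>ln (f i x)\<rfloor> = \<lfloor>ln (f i y)\<rfloor>" using fun_cong[OF xy(3), of i] that by (simp add: code_def)
      then show ?thesis by linarith
    qed
    have xyD: "x \<in> D" "y \<in> D" using xy Y by auto
    have pos: "\<phi> i (- \<delta>) (u, 1) > 0" if "i \<in> I" "u \<in> Y" for i u
      using fpos[OF that(2,1)] h[of u] that Y by (auto simp: f_def zero_less_divide_iff)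
    obtain L N where LN: "L \<in> (\<lambda>i. \<phi> i (- \<delta>)) ` I" "N \<in> (\<lambda>i. \<phi> i (- \<delta>)) ` I"
      "affine_hilbert_dist D x y \<le> 1 / 2 * (ln (L (y, 1) / L (x, 1)) + ln (N (x, 1) / N (y, 1)))"
    proof (rule affine_hilbert_dist_upper[OF D xyD xy(4), of "(\<lambda>i. \<phi> i (- \<delta>)) ` I"])
      fix a assume "a \<in> frontier D"
      then show "\<exists>L\<in>(\<lambda>i. \<phi> i (- \<delta>)) ` I. L (a, 1) \<le> 0"
        using polygon_approximation_frontier[OF D(1) S] by (force simp: \<phi>_def)
    qed (use lin\<phi> pos xy in auto)
    then obtain i j where ij: "i \<in> I" "j \<in> I" "L = \<phi> i (- \<delta>)" "N = \<phi> j (- \<delta>)" by blast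
    have lnf: "ln (\<phi> i (- \<delta>) (u, 1)) = ln (f i u) + ln (snd (S (u, 1)))" if "i \<in> I" "u \<in> Y" for i u
    proof -
      have "snd (S (u, 1)) > 0" using h that Y by blast
      then show ?thesis using pos[OF that] by (simp add: f_def ln_div)
    qed
    \<comment> \<open>The heights at \<open>x\<close> and \<open>y\<close> cancel between the two
      quotients, so only the normalised functions \<open>f\<close> remain.\<close>
    have "ln (L (y, 1) / L (x, 1)) + ln (N (x, 1) / N (y, 1))
        = (ln (f i y) - ln (f i x)) + (ln (f j x) - ln (f j y))"
      using pos[OF ij(1) xy(1)] pos[OF ij(1) xy(2)] pos[OF ij(2) xy(1)] pos[OF ij(2) xy(2)]
      by (simp add: ij(3,4) ln_div lnf[OF ij(1) xy(1)] lnf[OF ij(1) xy(2)]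
          lnf[OF ij(2) xy(1)] lnf[OF ij(2) xy(2)])
    also have "\<dots> < 2" using close[OF ij(1)] close[OF ij(2)] by linarith
    finally show False using LN(3) sep[OF xy(1,2,4)] by simp
  qed
  moreover have "finite (PiE I (\<lambda>_. J))" using I by (intro finite_PiE) (auto simp: J_def)
  ultimately have "finite Y" "card Y \<le> card (PiE I (\<lambda>_. J))"
    by (meson finite_imageD finite_subset, meson card_inj_on_le)
  then show ?thesis using card_PiE[OF I, of "\<lambda>_. J"] by (simp add: J_def)
qed

lemma polygonal_polynomial_growth:
  fixes D :: "(real^'n::finite) set"
  assumes A: "linear A" "bij A" and D: "open D" "bounded D" "convex D" "D \<noteq> {}"
    and G: "G_polygonal (affine_chart A ` D)"
  obtains c :: real and N :: nat where "c > 0" "N > 0"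
    "\<forall>\<rho>>0. \<exists>z\<in>D. \<forall>Y\<subseteq>D. (\<forall>y\<in>Y. affine_hilbert_dist D z y \<le> \<rho>) \<and>
       (\<forall>x\<in>Y. \<forall>y\<in>Y. x \<noteq> y \<longrightarrow> affine_hilbert_dist D x y \<ge> 1) \<longrightarrow>
       finite Y \<and> real (card Y) \<le> (c * (\<rho> + 1)) ^ N"
proof -
  obtain I :: "((real^'n) \<times> real) set" and w :: "real^'n" and R :: real
    where I: "finite I" "\<forall>i\<in>I. fst i \<bullet> w < snd i"
      and approx: "\<forall>\<delta>>0. \<exists>S. polygon_approximation I R \<delta> D S"
    using polygonal_normal_form[OF A D(3,4) G] .
  \<comment> \<open>Inserting 1 here and in \<open>M\<close> covers empty \<open>I\<close> and also
    gives \<open>ln (m / 2) \<le> 0 \<le> ln M\<close>.\<close>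
  define m where "m = Min (insert 1 ((\<lambda>i. snd i - fst i \<bullet> w) ` I))"
  have m: "m > 0" "\<And>i. i \<in> I \<Longrightarrow> m \<le> snd i - fst i \<bullet> w" "m \<le> 1"
    using I by (auto simp: m_def)
  define M where "M = Max (insert 1 ((\<lambda>i. snd i + norm (fst i) * R) ` I))"
  have M: "\<And>i. i \<in> I \<Longrightarrow> snd i + norm (fst i) * R \<le> M" "M \<ge> 1"
    using I(1) by (auto simp: M_def)
  \<comment> \<open>Of the summand 2, one unit pays for rounding and one for counting both ends of
    the integer interval. It also ensures
    \<open>c + 2 * \<rho> \<le> c * (\<rho> + 1)\<close>.\<close>
  define c where "c = ln M - ln (m / 2) + 2"
  have c: "c \<ge> 2" using m M by (simp add: c_def)
  show thesis
  \<comment> \<open>The successor keeps the exponent positive.\<close>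
  proof (rule that[of c "Suc (card I)"], use c in simp, simp, intro allI impI)
    fix \<rho> :: real assume \<rho>: "\<rho> > 0"
    define \<delta> where "\<delta> = m * exp (- 2 * \<rho>) / 4"
    have \<delta>: "\<delta> > 0" "4 * \<delta> \<le> m * exp (- 2 * \<rho>)" using m(1) by (auto simp: \<delta>_def)
    have "exp (- 2 * \<rho>) \<le> 1" using \<rho> by simp
    then have "\<delta> \<le> m / 4" using m(1) by (simp add: \<delta>_def)
    then have "\<delta> < m" using m(1) by linarith
    obtain S where S: "polygon_approximation I R \<delta> D S" using approx \<delta>(1) by blast
    \<comment> \<open>Since \<delta> is below the least slack \<open>m\<close>, the point
      \<open>w\<close> survives in every inner polytope; its preimage is the centre for this
      \<rho>.\<close>
    have "\<forall>i\<in>I. fst i \<bullet> w < snd i - \<delta>" using m(2) \<open>\<delta> < m\<close> by fastforce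
    then obtain z where z: "z \<in> D" "S (z, 1) = snd (S (z, 1)) *\<^sub>R (w, 1)"
      using S unfolding polygon_approximation_def by blast
    define J where "J = {\<lfloor>ln (m / 2) - 2 * \<rho>\<rfloor>..\<lfloor>ln M\<rfloor>}"
    have "ln (m / 2) - 2 * \<rho> \<le> ln M"
    proof -
      have "ln (m / 2) \<le> 0" "ln M \<ge> 0" using m M by auto
      then show ?thesis using \<rho> by linarith
    qed
    then have "\<lfloor>ln (m / 2) - 2 * \<rho>\<rfloor> \<le> \<lfloor>ln M\<rfloor>" by (rule floor_mono)
    then have "real (card J) = real_of_int \<lfloor>ln M\<rfloor> - real_of_int \<lfloor>ln (m / 2) - 2 * \<rho>\<rfloor> + 1"
      by (simp add: J_def)
    also have "\<dots> \<le> c + 2 * \<rho>" unfolding c_def by linarith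
    also have "\<dots> \<le> c * (\<rho> + 1)" using c \<rho> by (simp add: algebra_simps)
    finally have J: "real (card J) \<le> c * (\<rho> + 1)" .
    have c1: "1 \<le> c * (\<rho> + 1)" using mult_mono[of 1 c 1 "\<rho> + 1"] c \<rho> by simp
    have "finite Y \<and> real (card Y) \<le> (c * (\<rho> + 1)) ^ Suc (card I)"
      if Y: "Y \<subseteq> D" "\<forall>y\<in>Y. affine_hilbert_dist D z y \<le> \<rho>"
        "\<forall>x\<in>Y. \<forall>y\<in>Y. x \<noteq> y \<longrightarrow> affine_hilbert_dist D x y \<ge> 1" for Y
    proof -
      have "finite Y \<and> card Y \<le> card J ^ card I" unfolding J_def
        by (rule polygon_approximation_packing[OF D(1-3) I(1) S z])
           (use m M \<delta> Y in blast)+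
      then have "finite Y" "real (card Y) \<le> real (card J) ^ card I"
        by (auto simp flip: of_nat_power)
      moreover have "real (card J) ^ card I \<le> (c * (\<rho> + 1)) ^ card I"
        by (rule power_mono[OF J]) simp
      moreover have "\<dots> \<le> (c * (\<rho> + 1)) ^ Suc (card I)" by (rule power_increasing[OF _ c1]) simp
      ultimately show ?thesis by linarith
    qed
    then show "\<exists>z\<in>D. \<forall>Y\<subseteq>D. (\<forall>y\<in>Y. affine_hilbert_dist D z y \<le> \<rho>) \<and>
       (\<forall>x\<in>Y. \<forall>y\<in>Y. x \<noteq> y \<longrightarrow> affine_hilbert_dist D x y \<ge> 1) \<longrightarrow>
       finite Y \<and> real (card Y) \<le> (c * (\<rho> + 1)) ^ Suc (card I)"
      using z(1) by blast
  qed
qed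

section \<open>Transfer from the chart to projective space\<close>

theorem proposition23:
  fixes C :: "'n::finite rpn set"
  assumes "properly_open_convex C"
    and "G_polygonal C"
  shows "amenable C (hilbert_dist C)"
proof -
  \<comment> \<open>The very chart chosen inside \<open>hilbert_dist\<close>, so that distances in
    \<open>C\<close> unfold to distances in \<open>D\<close>.\<close>
  define A where "A = (SOME A. proper_chart A C)"
  have "\<exists>A. proper_chart A C" using assms(1) by (simp add: properly_open_convex_def)
  then have "proper_chart A C" unfolding A_def by (rule someI_ex)
  then obtain D where A: "linear A" "bij A" and D: "open D" "bounded D" "convex D" and C: "C = affine_chart A ` D"
    unfolding proper_chart_def by blast
  have "D \<noteq> {}" using assms(1) C by (auto simp: properly_open_convex_def)
  let ?\<phi> = "affine_chart A" and ?H = "affine_hilbert_dist D"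
  have inj: "inj ?\<phi>" by (rule inj_affine_chart[OF A])
  have dist: "hilbert_dist C (?\<phi> x) (?\<phi> y) = ?H x y" for x y
    unfolding hilbert_dist_def Let_def A_def[symmetric]
    using inj by (simp add: C inj_vimage_image_eq inv_f_f)
  have sym: "hilbert_dist C p q = hilbert_dist C q p" if "p \<in> C" "q \<in> C" for p q
    using that affine_hilbert_dist_commute[OF D] by (auto simp: C dist[unfolded C])
  have tri: "hilbert_dist C p r \<le> hilbert_dist C p q + hilbert_dist C q r"
    if "p \<in> C" "q \<in> C" "r \<in> C" for p q r
    using that affine_hilbert_dist_triangle[OF D] by (auto simp: C dist[unfolded C])
  obtain X where X: "X \<subseteq> C" "\<forall>x\<in>X. \<forall>y\<in>X. x \<noteq> y \<longrightarrow> hilbert_dist C x y \<ge> 1"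
    and max: "\<forall>Y. X \<subseteq> Y \<and> Y \<subseteq> C \<and>
      (\<forall>x\<in>Y. \<forall>y\<in>Y. x \<noteq> y \<longrightarrow> hilbert_dist C x y \<ge> 1) \<longrightarrow> Y = X"
    using maximal_separated_exists[where M = C and d = "hilbert_dist C" and r = 1] .
  have net: "separated_net C (hilbert_dist C) X"
    unfolding separated_net_def using X max by (intro exI[of _ 1] conjI) simp_all
  have dense: "\<exists>x\<in>X. hilbert_dist C z x \<le> 1" if z: "z \<in> C" for z
  proof (rule ccontr)
    assume *: "\<not> ?thesis"
    \<comment> \<open>A point farther than 1 from the whole net could be added to it, against
      maximality.\<close>
    have "insert z X = X"
    proof (rule max[rule_format], intro conjI)
      show "\<forall>x\<in>insert z X. \<forall>y\<in>insert z X. x \<noteq> y \<longrightarrow> hilbert_dist C x y \<ge> 1"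
        using * X z sym by (metis insert_iff linorder_le_cases subsetD)
    qed (use X z in auto)
    then have "z \<in> X" by blast
    moreover have "hilbert_dist C z z = 0" using z by (auto simp: C dist[unfolded C] affine_hilbert_dist_def)
    ultimately show False using * by force
  qed
  obtain c :: real and N :: nat where cN: "c > 0" "N > 0" and growth:
    "\<forall>\<rho>>0. \<exists>z\<in>D. \<forall>Y\<subseteq>D. (\<forall>y\<in>Y. ?H z y \<le> \<rho>) \<and> (\<forall>x\<in>Y. \<forall>y\<in>Y. x \<noteq> y \<longrightarrow> ?H x y \<ge> 1) \<longrightarrow>
       finite Y \<and> real (card Y) \<le> (c * (\<rho> + 1)) ^ N"
    using polygonal_polynomial_growth[OF A D \<open>D \<noteq> {}\<close> assms(2)[unfolded C]] .
  have growth_net: "\<exists>z\<in>C. finite {y\<in>X. hilbert_dist C z y \<le> \<rho>} \<and>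
      real (card {y\<in>X. hilbert_dist C z y \<le> \<rho>}) \<le> (c * (\<rho> + 1)) ^ N" if "\<rho> > 0" for \<rho>
  proof -
    obtain z where z: "z \<in> D" and zY: "\<And>Y. Y \<subseteq> D \<Longrightarrow> (\<forall>y\<in>Y. ?H z y \<le> \<rho>) \<Longrightarrow>
        (\<forall>x\<in>Y. \<forall>y\<in>Y. x \<noteq> y \<longrightarrow> ?H x y \<ge> 1) \<Longrightarrow> finite Y \<and> real (card Y) \<le> (c * (\<rho> + 1)) ^ N"
      using growth \<open>\<rho> > 0\<close> by meson
    define Y where "Y = {y\<in>D. ?\<phi> y \<in> X \<and> ?H z y \<le> \<rho>}"
    have "finite Y \<and> real (card Y) \<le> (c * (\<rho> + 1)) ^ N"
    proof (rule zY)
      show "\<forall>x\<in>Y. \<forall>y\<in>Y. x \<noteq> y \<longrightarrow> ?H x y \<ge> 1"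
        using X(2) inj by (auto simp: Y_def inj_eq simp flip: dist)
    qed (auto simp: Y_def)
    moreover have "{y\<in>X. hilbert_dist C (?\<phi> z) y \<le> \<rho>} = ?\<phi> ` Y"
      using X(1) by (auto simp: Y_def dist) (auto simp: C dist[unfolded C])
    moreover have "card (?\<phi> ` Y) = card Y" using inj by (intro card_image) (rule inj_on_subset, auto)
    ultimately show ?thesis using z C by (intro bexI[of _ "?\<phi> z"]) auto
  qed
  have "amenable_pseudogroup (hilbert_dist C) X"
  proof (rule amenable_pseudogroup_Folner)
    show "hilbert_dist C p q = hilbert_dist C q p" if "p \<in> X" "q \<in> X" for p q
      using sym that X(1) by blast
    show "\<exists>F B. finite F \<and> F \<noteq> {} \<and> F \<subseteq> X \<and> finite B \<and> F \<subseteq> B \<and>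
      real (card B) \<le> (1 + e) * real (card F) \<and> (\<forall>x\<in>X. \<forall>y\<in>F. hilbert_dist C x y \<le> R \<longrightarrow> x \<in> B)"
      if "R > 0" "e > 0" for R e
    proof (rule Folner_of_polynomial_growth)
      show "hilbert_dist C p q = hilbert_dist C q p" if "p \<in> C" "q \<in> C" for p q
        using sym that .
      show "hilbert_dist C p r \<le> hilbert_dist C p q + hilbert_dist C q r"
        if "p \<in> C" "q \<in> C" "r \<in> C" for p q r
        using tri that .
      show "\<exists>x\<in>X. hilbert_dist C z x \<le> 1" if "z \<in> C" for z using dense that .
      show "\<exists>z\<in>C. finite {y\<in>X. hilbert_dist C z y \<le> \<rho>} \<and>
          real (card {y\<in>X. hilbert_dist C z y \<le> \<rho>}) \<le> (c * (\<rho> + 1)) ^ N" if "\<rho> > 0" for \<rho>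
        using growth_net that .
    qed (fact X(1) cN that)+
  qed
  then show ?thesis using net unfolding amenable_def by blast
qed

end
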